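(* Let $(R,\mathfrak{m},K)$ be a local Artinian commutative ring that is Frobenius, let $n\ge 1$, and let $C\subseteq R^n$ be an $R$-code. Then $$W_{C^\perp}(x,y,z)=\frac{1}{z^{\lambda(C)}}\,W_C\bigl(x+z^{\lambda(R)}y-y,\;x-y,\;z\bigr)$$ as an identity in $\mathbb{Z}[x,y,z,z^{-1}]$.
   Context: All rings are commutative with unity. $(R,\mathfrak{m},K)$ is a local Artinian ring with maximal ideal $\mathfrak{m}$ and residue field $K=R/\mathfrak{m}$ (not necessarily finite). $R$ is Frobenius if $\operatorname{soc}(R)=\{r\in R:\mathfrak{m}r=0\}\cong K$. An $R$-code of length $n$ is an $R$-submodule $C\subseteq R^n$. $\lambda(M)$ denotes the length of an $R$-module $M$. The orthogonal code is $C^\perp=\{v\in R^n : v\cdot w=0 \text{ for all } w\in C\}$, where $v\cdot w=v_1w_1+\cdots+v_nw_n$. Let $[n]=\{1,\dots,n\}$ and $\operatorname{supp}(v)=\{i : v_i\ne 0\}$. For $\mathcal{A}\subseteq[n]$, $C(\mathcal{A})=\{v\in C : \operatorname{supp}(v)\subseteq\mathcal{A}\}$. For $0\le i\le n$ the $i$-th weight polynomial is $$g^C_i(z)=\sum_{a=0}^{i}\ \sum_{\mathcal{A}\subseteq[n],\,|\mathcal{A}|=a}(-1)^{i-a}\binom{n-a}{i-a}z^{\lambda(C(\mathcal{A}))},$$ and the weight enumerator of $C$ is $W_C(x,y,z)=\sum_{i=0}^n g^C_i(z)\,x^{n-i}y^i$. *)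

theory Defs
  imports "HOL-Library.Poly_Mapping" "HOL-Library.Product_Plus" "HOL-Library.Extended_Nat"
    "HOL-Algebra.Module" "HOL-Algebra.QuotRing"
begin

section \<open>Modules over a commutative ring\<close>

text \<open>
  The record type of modules extends that of rings, so the ring fields \<open>mult\<close> and \<open>one\<close> have to be
  filled in below; the locales \<open>module\<close> and \<open>submodule\<close> ignore them.
\<close>

definition regular_module :: "('a, 'c) ring_scheme \<Rightarrow> ('a, 'a) module"
  where "regular_module R =
    \<lparr>carrier = carrier R, monoid.mult = monoid.mult R, monoid.one = monoid.one R,
     ring.zero = ring.zero R, ring.add = ring.add R, smult = monoid.mult R\<rparr>"

definition quotient_module :: "('a, 'c) ring_scheme \<Rightarrow> 'a set \<Rightarrow> ('a, 'a set) module"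
  where "quotient_module R I =
    \<lparr>carrier = carrier (R Quot I), monoid.mult = monoid.mult (R Quot I), monoid.one = monoid.one (R Quot I),
     ring.zero = ring.zero (R Quot I), ring.add = ring.add (R Quot I),
     smult = (\<lambda>r X. (I +>\<^bsub>R\<^esub> r) \<otimes>\<^bsub>R Quot I\<^esub> X)\<rparr>"

definition free_module :: "('a, 'c) ring_scheme \<Rightarrow> nat \<Rightarrow> ('a, nat \<Rightarrow> 'a) module"
  where "free_module R n =
    \<lparr>carrier = {1..n} \<rightarrow>\<^sub>E carrier R,
     monoid.mult = (\<lambda>v w. \<lambda>i\<in>{1..n}. v i \<otimes>\<^bsub>R\<^esub> w i),
     monoid.one = (\<lambda>i\<in>{1..n}. \<one>\<^bsub>R\<^esub>),
     ring.zero = (\<lambda>i\<in>{1..n}. \<zero>\<^bsub>R\<^esub>),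
     ring.add = (\<lambda>v w. \<lambda>i\<in>{1..n}. v i \<oplus>\<^bsub>R\<^esub> w i),
     smult = (\<lambda>r v. \<lambda>i\<in>{1..n}. r \<otimes>\<^bsub>R\<^esub> v i)\<rparr>"

definition module_isomorphic ::
    "('a, 'c) ring_scheme \<Rightarrow> ('a, 'm, 'd) module_scheme \<Rightarrow> ('a, 'n, 'e) module_scheme \<Rightarrow> bool"
  where "module_isomorphic R M N \<longleftrightarrow>
    (\<exists>f. bij_betw f (carrier M) (carrier N) \<and>
      (\<forall>x\<in>carrier M. \<forall>y\<in>carrier M. f (x \<oplus>\<^bsub>M\<^esub> y) = f x \<oplus>\<^bsub>N\<^esub> f y) \<and>
      (\<forall>r\<in>carrier R. \<forall>x\<in>carrier M. f (r \<odot>\<^bsub>M\<^esub> x) = r \<odot>\<^bsub>N\<^esub> f x))"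

text \<open>The length \<open>\<lambda>(M)\<close>: the supremum of the lengths \<open>k\<close> of chains \<open>N 0 \<subset> \<dots> \<subset> N k\<close> of submodules.\<close>

definition module_length :: "('a, 'c) ring_scheme \<Rightarrow> ('a, 'm, 'd) module_scheme \<Rightarrow> enat"
  where "module_length R M =
    (SUP k \<in> {k. \<exists>N :: nat \<Rightarrow> 'm set. (\<forall>i\<le>k. submodule (N i) R M) \<and> (\<forall>i<k. N i \<subset> N (Suc i))}.
      enat k)"


section \<open>Local Artinian and Frobenius rings\<close>

locale local_artinian_ring = cring R for R (structure) +
  fixes \<mm> :: "'a set"
  assumes maximal: "maximalideal \<mm> R"
    and unique_maximal: "maximalideal J R \<Longrightarrow> J = \<mm>"
    and descending_chain: "\<lbrakk>\<And>k :: nat. ideal (I k) R; \<And>k. I (Suc k) \<subseteq> I k\<rbrakk>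
      \<Longrightarrow> \<exists>N. \<forall>k\<ge>N. I k = I N"

definition socle :: "('a, 'c) ring_scheme \<Rightarrow> 'a set \<Rightarrow> 'a set"
  where "socle R \<mm> = {r \<in> carrier R. \<forall>a\<in>\<mm>. a \<otimes>\<^bsub>R\<^esub> r = \<zero>\<^bsub>R\<^esub>}"

locale frobenius_ring = local_artinian_ring +
  assumes socle_iso: "module_isomorphic R ((regular_module R)\<lparr>carrier := socle R \<mm>\<rparr>) (quotient_module R \<mm>)"


section \<open>Codes\<close>

abbreviation is_code :: "('a, 'c) ring_scheme \<Rightarrow> nat \<Rightarrow> (nat \<Rightarrow> 'a) set \<Rightarrow> bool"
  where "is_code R n C \<equiv> submodule C R (free_module R n)"

definition dot :: "('a, 'c) ring_scheme \<Rightarrow> nat \<Rightarrow> (nat \<Rightarrow> 'a) \<Rightarrow> (nat \<Rightarrow> 'a) \<Rightarrow> 'a"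
  where "dot R n v w = (\<Oplus>\<^bsub>R\<^esub>i\<in>{1..n}. v i \<otimes>\<^bsub>R\<^esub> w i)"

definition orthogonal_code :: "('a, 'c) ring_scheme \<Rightarrow> nat \<Rightarrow> (nat \<Rightarrow> 'a) set \<Rightarrow> (nat \<Rightarrow> 'a) set"
  where "orthogonal_code R n C =
    {v \<in> carrier (free_module R n). \<forall>w\<in>C. dot R n v w = \<zero>\<^bsub>R\<^esub>}"

definition supp :: "('a, 'c) ring_scheme \<Rightarrow> nat \<Rightarrow> (nat \<Rightarrow> 'a) \<Rightarrow> nat set"
  where "supp R n v = {i \<in> {1..n}. v i \<noteq> \<zero>\<^bsub>R\<^esub>}"

definition supported_code ::
    "('a, 'c) ring_scheme \<Rightarrow> nat \<Rightarrow> (nat \<Rightarrow> 'a) set \<Rightarrow> nat set \<Rightarrow> (nat \<Rightarrow> 'a) set"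
  where "supported_code R n C A = {v \<in> C. supp R n v \<subseteq> A}"

text \<open>
  Lengths are used as exponents, hence the conversion to \<^typ>\<open>nat\<close>. Over an Artinian ring every code
  and the ring itself have finite length, so nothing is lost; on infinite lengths the value is
  unspecified.
\<close>

definition code_length :: "('a, 'c) ring_scheme \<Rightarrow> nat \<Rightarrow> (nat \<Rightarrow> 'a) set \<Rightarrow> nat"
  where "code_length R n C = the_enat (module_length R ((free_module R n)\<lparr>carrier := C\<rparr>))"

definition ring_length :: "('a, 'c) ring_scheme \<Rightarrow> nat"
  where "ring_length R = the_enat (module_length R (regular_module R))"


section \<open>Weight polynomials and the weight enumerator\<close>

text \<open>
  Polynomials with integer coefficients are given by their evaluation at elements of an arbitrary
  commutative ring. The polynomials themselves are the values at the indeterminates, and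
  substitution is evaluation at other elements.
\<close>

definition weight_poly ::
    "('a, 'c) ring_scheme \<Rightarrow> nat \<Rightarrow> (nat \<Rightarrow> 'a) set \<Rightarrow> nat \<Rightarrow> 'p::comm_ring_1 \<Rightarrow> 'p"
  where "weight_poly R n C i z =
    (\<Sum>a=0..i. \<Sum>A | A \<subseteq> {1..n} \<and> card A = a.
      (-1) ^ (i - a) * of_nat ((n - a) choose (i - a)) * z ^ code_length R n (supported_code R n C A))"

definition weight_enumerator ::
    "('a, 'c) ring_scheme \<Rightarrow> nat \<Rightarrow> (nat \<Rightarrow> 'a) set \<Rightarrow> 'p::comm_ring_1 \<Rightarrow> 'p \<Rightarrow> 'p \<Rightarrow> 'p"
  where "weight_enumerator R n C x y z = (\<Sum>i=0..n. weight_poly R n C i z * x ^ (n - i) * y ^ i)"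

text \<open>
  The ring \<open>\<int>[x, y, z, z\<^sup>-\<^sup>1]\<close> as the monoid ring of \<open>\<nat> \<times> \<nat> \<times> \<int>\<close> over the integers: a key
  \<open>(a, b, c)\<close> stands for the monomial \<open>x\<^sup>a y\<^sup>b z\<^sup>c\<close>.
\<close>

type_synonym laurent = "(nat \<times> nat \<times> int) \<Rightarrow>\<^sub>0 int"

definition var_x :: laurent where "var_x = Poly_Mapping.single (1, 0, 0) 1"
definition var_y :: laurent where "var_y = Poly_Mapping.single (0, 1, 0) 1"
definition var_z :: laurent where "var_z = Poly_Mapping.single (0, 0, 1) 1"
definition var_z_inv :: laurent where "var_z_inv = Poly_Mapping.single (0, 0, -1) 1"

end

theory Submission
  imports Defs
begin

text \<open>
  Exchanging the order of summation in the weight enumerator and applying the binomial theorem gives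
  \<open>W\<^sub>C(x, y, z) = (\<Sum>A\<subseteq>[n]. z\<^bsup>\<lambda>(C(A))\<^esup> y\<^bsup>|A|\<^esup> (x - y)\<^bsup>n - |A|\<^esup>)\<close>, see \<open>weight_enumerator_eq\<close>. The substitution
  \<open>x \<mapsto> x + z\<^bsup>\<lambda>(R)\<^esup> y - y\<close>, \<open>y \<mapsto> x - y\<close> replaces \<open>y\<close> by \<open>x - y\<close> and \<open>x - y\<close> by \<open>z\<^bsup>\<lambda>(R)\<^esup> y\<close>. Matching the term of \<open>A\<close> on one
  side with the term of its complement \<open>B\<close> on the other, the identity reduces to a statement about lengths
  for every \<open>B\<close>, namely \<open>\<lambda>(C) + \<lambda>(C\<^sup>\<bottom>(B)) = \<lambda>(C(A)) + |B| \<lambda>(R)\<close> (\<open>supported_dual_code_length\<close>).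

  By projecting onto the coordinates in \<open>B\<close>, this follows from the case \<open>\<lambda>(D) + \<lambda>(D\<^sup>\<bottom>) = n \<lambda>(R)\<close>
  (\<open>dual_code_length\<close>). There the Frobenius property enters through the socle. If \<open>D \<subset> E\<close> with \<open>E / D\<close> simple, pairing with a generator of \<open>E\<close> over
  \<open>D\<close> embeds \<open>D\<^sup>\<bottom> / E\<^sup>\<bottom>\<close> into the socle, which has length one. So \<open>\<lambda>(D) + \<lambda>(D\<^sup>\<bottom>)\<close> can only grow when the code grows
  (\<open>dual_length_sum_mono\<close>). It has the same value at the zero code and at the whole space, hence everywhere.

  All comparisons of lengths go through one fact, the additivity of length on the kernel and the image of a
  linear map (\<open>submodule_length_kernel_image\<close>). They can be subtracted because all lengths are finite: the
  descending chain condition for ideals and the length of the socle bound the length of \<open>R\<close>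
  (\<open>ideal_length_finite\<close>).
\<close>


section \<open>Lengths of submodules and chains\<close>

lemma (in module) submodule_iff:
  "submodule N R M \<longleftrightarrow> N \<subseteq> carrier M \<and> \<zero>\<^bsub>M\<^esub> \<in> N \<and>
    (\<forall>x\<in>N. \<forall>y\<in>N. x \<oplus>\<^bsub>M\<^esub> y \<in> N) \<and> (\<forall>r\<in>carrier R. \<forall>x\<in>N. r \<odot>\<^bsub>M\<^esub> x \<in> N)"
proof
  assume N: "submodule N R M"
  have "\<zero>\<^bsub>M\<^esub> \<in> N"
    using subgroup.one_closed[OF submodule.axioms(1)[OF N]] by simp
  then show "N \<subseteq> carrier M \<and> \<zero>\<^bsub>M\<^esub> \<in> N \<and>
    (\<forall>x\<in>N. \<forall>y\<in>N. x \<oplus>\<^bsub>M\<^esub> y \<in> N) \<and> (\<forall>r\<in>carrier R. \<forall>x\<in>N. r \<odot>\<^bsub>M\<^esub> x \<in> N)"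
    using submoduleE[OF N] by blast
next
  assume *: "N \<subseteq> carrier M \<and> \<zero>\<^bsub>M\<^esub> \<in> N \<and>
    (\<forall>x\<in>N. \<forall>y\<in>N. x \<oplus>\<^bsub>M\<^esub> y \<in> N) \<and> (\<forall>r\<in>carrier R. \<forall>x\<in>N. r \<odot>\<^bsub>M\<^esub> x \<in> N)"
  show "submodule N R M"
  proof (rule submoduleI)
    fix a assume "a \<in> N"
    then have "(\<ominus>\<^bsub>R\<^esub> \<one>\<^bsub>R\<^esub>) \<odot>\<^bsub>M\<^esub> a \<in> N" "a \<in> carrier M"
      using * by auto
    then show "\<ominus>\<^bsub>M\<^esub> a \<in> N"
      using smult_l_minus[OF R.one_closed, of a] by simp
  qed (use * in auto)
qed

lemma (in module) zero_submodule: "submodule {\<zero>\<^bsub>M\<^esub>} R M"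
  by (auto simp: submodule_iff)

lemma (in module) submodule_of_submodule:
  assumes "submodule B R M"
  shows "submodule N R (M\<lparr>carrier := B\<rparr>) \<longleftrightarrow> submodule N R M \<and> N \<subseteq> B"
proof -
  interpret B: module R "M\<lparr>carrier := B\<rparr>"
    using assms by (rule submodule.submodule_is_module) (rule module_axioms)
  show ?thesis
    unfolding B.submodule_iff submodule_iff using assms unfolding submodule_iff by auto
qed


abbreviation submodule_length ::
    "('a, 'c) ring_scheme \<Rightarrow> ('a, 'm, 'd) module_scheme \<Rightarrow> 'm set \<Rightarrow> enat"
  where "submodule_length R M N \<equiv> module_length R (M\<lparr>carrier := N\<rparr>)"

definition submodule_chain ::
    "('a, 'c) ring_scheme \<Rightarrow> ('a, 'm, 'd) module_scheme \<Rightarrow> (nat \<Rightarrow> 'm set) \<Rightarrow> nat \<Rightarrow> bool"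
  where "submodule_chain R M N k \<longleftrightarrow>
    (\<forall>i\<le>k. submodule (N i) R M) \<and> (\<forall>i<k. N i \<subset> N (Suc i))"

lemma submodule_chain_mono:
  assumes "submodule_chain R M N k" "i \<le> j" "j \<le> k"
  shows "N i \<subseteq> N j"
  using assms(2,3)
proof (induction j rule: dec_induct)
  case (step j)
  then show ?case
    using assms(1) unfolding submodule_chain_def by (meson Suc_le_eq less_imp_le psubsetE subset_trans)
qed simp

text \<open>
  Submodules of a submodule \<open>B\<close> are the submodules of \<open>M\<close> inside \<open>B\<close>, so lengths can be measured by
  chains of the ambient module whose top member lies in \<open>B\<close>. This and the next lemma are the two halves
  of that description; all later facts about lengths rest on them.
\<close>

lemma (in module) chain_le_submodule_length:
  assumes "submodule B R M" "submodule_chain R M N k" "N k \<subseteq> B"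
  shows "enat k \<le> submodule_length R M B"
proof -
  have "N i \<subseteq> B" if "i \<le> k" for i
    using submodule_chain_mono[OF assms(2) that order_refl] assms(3) by blast
  then show ?thesis
    using assms(2) unfolding module_length_def submodule_chain_def
    by (intro SUP_upper) (auto simp: submodule_of_submodule[OF assms(1)])
qed

lemma (in module) submodule_length_le:
  assumes "submodule B R M"
    and "\<And>N k. submodule_chain R M N k \<Longrightarrow> N k \<subseteq> B \<Longrightarrow> enat k \<le> l"
  shows "submodule_length R M B \<le> l"
  unfolding module_length_def
proof (rule SUP_least, clarify)
  fix k and N :: "nat \<Rightarrow> 'c set"
  assume "\<forall>i\<le>k. submodule (N i) R (M\<lparr>carrier := B\<rparr>)" "\<forall>i<k. N i \<subset> N (Suc i)"
  then show "enat k \<le> l"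
    by (intro assms(2)[of N]) (auto simp: submodule_chain_def submodule_of_submodule[OF assms(1)])
qed

lemma (in module) submodule_length_mono:
  assumes "submodule A R M" "submodule B R M" "A \<subseteq> B"
  shows "submodule_length R M A \<le> submodule_length R M B"
  using assms by (intro submodule_length_le) (auto intro: chain_le_submodule_length)

lemma (in module) submodule_length_strict_mono:
  assumes "submodule A R M" "submodule B R M" "A \<subset> B"
  shows "submodule_length R M A + 1 \<le> submodule_length R M B"
proof (cases "submodule_length R M B")
  case (enat m)
  have *: "Suc k \<le> m" if "submodule_chain R M N k" "N k \<subseteq> A" for N k
  proof -
    have "submodule_chain R M (N(Suc k := B)) (Suc k)"
      using that assms unfolding submodule_chain_def by (auto simp: less_Suc_eq le_Suc_eq)
    then have "enat (Suc k) \<le> submodule_length R M B"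
      by (rule chain_le_submodule_length[OF assms(2)]) simp
    then show ?thesis
      by (simp add: enat)
  qed
  have "submodule_chain R M (\<lambda>_. A) 0"
    using assms(1) by (simp add: submodule_chain_def)
  from *[OF this] have "1 \<le> m"
    by simp
  have "submodule_length R M A \<le> enat (m - 1)"
    using * by (intro submodule_length_le[OF assms(1)]) fastforce
  then have "submodule_length R M A + 1 \<le> enat (m - 1) + 1"
    by (rule add_right_mono)
  also have "\<dots> = enat m"
    using \<open>1 \<le> m\<close> by (simp add: one_enat_def)
  finally show ?thesis
    by (simp add: enat)
qed simp

lemma (in module) submodule_length_zero: "submodule_length R M {\<zero>\<^bsub>M\<^esub>} = 0"
proof -
  have "enat k \<le> 0" if N: "submodule_chain R M N k" "N k \<subseteq> {\<zero>\<^bsub>M\<^esub>}" for N k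
  proof (cases k)
    case (Suc j)
    then have "submodule (N 0) R M" "N 0 \<subset> N 1"
      using N(1) by (auto simp: submodule_chain_def)
    moreover have "N 1 \<subseteq> {\<zero>\<^bsub>M\<^esub>}"
      using submodule_chain_mono[OF N(1), of 1 k] N(2) Suc by auto
    ultimately show ?thesis
      by (auto simp: submodule_iff)
  qed (simp add: zero_enat_def)
  then have "submodule_length R M {\<zero>\<^bsub>M\<^esub>} \<le> 0"
    by (intro submodule_length_le zero_submodule)
  then show ?thesis by simp
qed


section \<open>Length of kernel and image\<close>

definition module_hom ::
    "('a, 'c) ring_scheme \<Rightarrow> ('a, 'm, 'd) module_scheme \<Rightarrow> ('a, 'n, 'e) module_scheme \<Rightarrow> ('m \<Rightarrow> 'n) set"
  where "module_hom R M N = {f \<in> carrier M \<rightarrow> carrier N.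
    (\<forall>x\<in>carrier M. \<forall>y\<in>carrier M. f (x \<oplus>\<^bsub>M\<^esub> y) = f x \<oplus>\<^bsub>N\<^esub> f y) \<and>
    (\<forall>r\<in>carrier R. \<forall>x\<in>carrier M. f (r \<odot>\<^bsub>M\<^esub> x) = r \<odot>\<^bsub>N\<^esub> f x)}"

context
  fixes R :: "('a, 'c) ring_scheme" and M :: "('a, 'm, 'd) module_scheme"
    and N :: "('a, 'n, 'e) module_scheme" and f :: "'m \<Rightarrow> 'n"
  assumes M: "module R M" and N: "module R N" and f: "f \<in> module_hom R M N"
begin

interpretation M: module R M by (rule M)
interpretation N: module R N by (rule N)

lemma module_hom_closed: "x \<in> carrier M \<Longrightarrow> f x \<in> carrier N"
  and module_hom_add: "x \<in> carrier M \<Longrightarrow> y \<in> carrier M \<Longrightarrow> f (x \<oplus>\<^bsub>M\<^esub> y) = f x \<oplus>\<^bsub>N\<^esub> f y"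
  and module_hom_smult: "r \<in> carrier R \<Longrightarrow> x \<in> carrier M \<Longrightarrow> f (r \<odot>\<^bsub>M\<^esub> x) = r \<odot>\<^bsub>N\<^esub> f x"
  using f by (auto simp: module_hom_def)

lemma module_hom_zero: "f \<zero>\<^bsub>M\<^esub> = \<zero>\<^bsub>N\<^esub>"
  using module_hom_smult[of "\<zero>\<^bsub>R\<^esub>" "\<zero>\<^bsub>M\<^esub>"] module_hom_closed[of "\<zero>\<^bsub>M\<^esub>"] by simp

lemma submodule_image:
  assumes "submodule B R M"
  shows "submodule (f ` B) R N"
  unfolding N.submodule_iff
proof (intro conjI ballI)
  have B: "B \<subseteq> carrier M" "\<zero>\<^bsub>M\<^esub> \<in> B"
    using assms by (auto simp: M.submodule_iff)
  show "f ` B \<subseteq> carrier N"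
    using B module_hom_closed by auto
  show "\<zero>\<^bsub>N\<^esub> \<in> f ` B"
    using B(2) module_hom_zero by force
  show "u \<oplus>\<^bsub>N\<^esub> v \<in> f ` B" if uv: "u \<in> f ` B" "v \<in> f ` B" for u v
  proof -
    obtain x y where xy: "x \<in> B" "y \<in> B" "u = f x" "v = f y"
      using uv by auto
    moreover have "x \<oplus>\<^bsub>M\<^esub> y \<in> B"
      using assms xy by (auto simp: M.submodule_iff)
    ultimately show ?thesis
      using module_hom_add[of x y] B(1) by (metis imageI subsetD)
  qed
  show "r \<odot>\<^bsub>N\<^esub> u \<in> f ` B" if ru: "r \<in> carrier R" "u \<in> f ` B" for r u
  proof -
    obtain x where x: "x \<in> B" "u = f x"
      using ru by auto
    moreover have "r \<odot>\<^bsub>M\<^esub> x \<in> B"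
      using assms x ru by (auto simp: M.submodule_iff)
    ultimately show ?thesis
      using module_hom_smult[of r x] B(1) ru(1) by (metis imageI subsetD)
  qed
qed

lemma submodule_preimage:
  assumes "submodule B R M" "submodule U R N"
  shows "submodule {x \<in> B. f x \<in> U} R M"
  using assms module_hom_add module_hom_smult module_hom_zero
  unfolding M.submodule_iff N.submodule_iff by (auto simp: subset_iff)

lemma submodule_kernel:
  assumes "submodule B R M"
  shows "submodule {x \<in> B. f x = \<zero>\<^bsub>N\<^esub>} R M"
  using submodule_preimage[OF assms N.zero_submodule] by simp

text \<open>
  Modularity in disguise: if \<open>f b = f a\<close> with \<open>b\<close> in \<open>B\<close> outside \<open>A\<close> and \<open>a\<close> in \<open>A\<close>, then \<open>b - a\<close> is an element of the
  kernel on \<open>B\<close> outside \<open>A\<close>. A strict inclusion is therefore visible in the image or in the kernel.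
\<close>

lemma psubset_kernel_or_image:
  assumes "submodule A R M" "submodule B R M" "A \<subset> B"
    and image: "f ` A = f ` B"
  shows "{x \<in> A. f x = \<zero>\<^bsub>N\<^esub>} \<subset> {x \<in> B. f x = \<zero>\<^bsub>N\<^esub>}"
proof -
  obtain b where b: "b \<in> B" "b \<notin> A"
    using assms(3) by auto
  then obtain a where a: "a \<in> A" "f a = f b"
    using image by (metis imageE imageI)
  have sub: "A \<subseteq> carrier M" "B \<subseteq> carrier M"
    using assms(1,2) by (auto simp: M.submodule_iff)
  then have c: "a \<in> carrier M" "b \<in> carrier M"
    using a b by auto
  define d where "d = b \<ominus>\<^bsub>M\<^esub> a"
  have bd: "b = d \<oplus>\<^bsub>M\<^esub> a" and dc: "d \<in> carrier M"
    unfolding d_def using c by (auto simp: a_minus_def M.M.a_assoc M.M.l_neg)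
  have "f d \<oplus>\<^bsub>N\<^esub> f a = f a"
    using module_hom_add[OF dc c(1)] bd a(2) by simp
  then have "f d = \<zero>\<^bsub>N\<^esub>"
    using module_hom_closed[OF dc] module_hom_closed[OF c(1)] by (simp add: N.M.add.r_cancel_one')
  moreover have "d \<in> B"
    unfolding d_def a_minus_def
    using M.submoduleE(3,5)[OF assms(2)] a(1) b(1) assms(3) by blast
  moreover have "d \<notin> A"
    using bd b(2) a(1) M.submoduleE(5)[OF assms(1)] by auto
  ultimately show ?thesis
    using assms(3) by blast
qed

text \<open>
  For \<open>\<le>\<close>, run along a chain in \<open>B\<close>: by the previous lemma each strict step enlarges the kernel part or the
  image, so the sum of the two lengths grows by at least one. For \<open>\<ge>\<close>, the preimages of a chain in the image
  form a chain above the kernel.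
\<close>

theorem submodule_length_kernel_image:
  assumes B: "submodule B R M"
  shows "submodule_length R M B =
    submodule_length R M {x \<in> B. f x = \<zero>\<^bsub>N\<^esub>} + submodule_length R N (f ` B)"
proof (rule antisym)
  let ?ker = "\<lambda>A. {x \<in> A. f x = \<zero>\<^bsub>N\<^esub>}"
  let ?l = "\<lambda>A. submodule_length R M (?ker A) + submodule_length R N (f ` A)"
  have l_mono: "?l A + (if A = A' then 0 else 1) \<le> ?l A'"
    if A: "submodule A R M" "submodule A' R M" "A \<subseteq> A'" for A A'
  proof -
    have le: "submodule_length R M (?ker A) \<le> submodule_length R M (?ker A')"
      "submodule_length R N (f ` A) \<le> submodule_length R N (f ` A')"
      using A by (auto intro!: M.submodule_length_mono N.submodule_length_mono submodule_image submodule_kernel)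
    consider "A = A'" | "f ` A \<subset> f ` A'" | "A \<subset> A'" "f ` A = f ` A'"
      using A(3) by blast
    then show ?thesis
    proof cases
      case 1
      then show ?thesis by simp
    next
      case 2
      then have "submodule_length R N (f ` A) + 1 \<le> submodule_length R N (f ` A')"
        using A by (auto intro!: N.submodule_length_strict_mono submodule_image)
      from add_mono[OF le(1) this] show ?thesis
        using 2 by (auto simp: add.assoc)
    next
      case 3
      then have "submodule_length R M (?ker A) + 1 \<le> submodule_length R M (?ker A')"
        using A by (intro M.submodule_length_strict_mono submodule_kernel psubset_kernel_or_image)
      from add_mono[OF this le(2)] show ?thesis
        using 3 by (auto simp: ac_simps)
    qed
  qed
  show "submodule_length R M B \<le> ?l B"
  proof (rule M.submodule_length_le[OF B])
    fix K k assume K: "submodule_chain R M K k" "K k \<subseteq> B"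
    have "enat i \<le> ?l (K i)" if "i \<le> k" for i
      using that
    proof (induction i)
      case (Suc i)
      have "enat (Suc i) = enat i + 1"
        by (simp add: one_enat_def)
      also have "\<dots> \<le> ?l (K i) + 1"
        using Suc by (intro add_right_mono) simp
      also have "\<dots> \<le> ?l (K (Suc i))"
      proof -
        have strict: "K i \<subset> K (Suc i)"
          using K(1) Suc.prems by (simp add: submodule_chain_def)
        then have "K i \<noteq> K (Suc i)"
          by blast
        moreover have "?l (K i) + (if K i = K (Suc i) then 0 else 1) \<le> ?l (K (Suc i))"
          using K(1) Suc.prems strict by (intro l_mono) (simp_all add: submodule_chain_def less_imp_le)
        ultimately show ?thesis
          by simp
      qed
      finally show ?case .
    qed (simp add: zero_enat_def[symmetric])
    from this[of k] have "enat k \<le> ?l (K k)"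
      by simp
    also have "\<dots> \<le> ?l (K k) + (if K k = B then 0 else 1)"
      by simp
    also have "\<dots> \<le> ?l B"
      using K by (intro l_mono B) (auto simp: submodule_chain_def)
    finally show "enat k \<le> ?l B" .
  qed
  show "?l B \<le> submodule_length R M B"
  proof (cases "submodule_length R M B")
    case (enat m)
    have "submodule_length R M (?ker B) \<le> enat m"
      using M.submodule_length_mono[OF submodule_kernel[OF B] B] enat by auto
    then obtain j where j: "submodule_length R M (?ker B) = enat j" "j \<le> m"
      by (cases "submodule_length R M (?ker B)") auto
    have "submodule_length R N (f ` B) \<le> enat (m - j)"
    proof (rule N.submodule_length_le[OF submodule_image[OF B]])
      fix K k assume K: "submodule_chain R N K k" "K k \<subseteq> f ` B"
      let ?P = "\<lambda>i. {x \<in> B. f x \<in> K i}"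
      have P: "submodule (?P i) R M" if "i \<le> k" for i
        using that K(1) by (intro submodule_preimage B) (simp add: submodule_chain_def)
      have "enat (j + i) \<le> submodule_length R M (?P i)" if "i \<le> k" for i
        using that
      proof (induction i)
        case 0
        have "submodule (K 0) R N"
          using K(1) by (simp add: submodule_chain_def)
        then have "?ker B \<subseteq> ?P 0"
          by (auto simp: N.submodule_iff)
        then show ?case
          using M.submodule_length_mono[OF submodule_kernel[OF B] P] j by simp
      next
        case (Suc i)
        have "K (Suc i) \<subseteq> f ` B"
          using submodule_chain_mono[OF K(1), of "Suc i" k] Suc.prems K(2) by auto
        moreover have "K i \<subset> K (Suc i)"
          using K(1) Suc.prems by (auto simp: submodule_chain_def)
        ultimately have "?P i \<subset> ?P (Suc i)"
          by blast
        then have strict: "submodule_length R M (?P i) + 1 \<le> submodule_length R M (?P (Suc i))"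
          using Suc.prems P by (intro M.submodule_length_strict_mono) auto
        have "enat (j + Suc i) = enat (j + i) + 1"
          by (simp add: one_enat_def)
        also have "\<dots> \<le> submodule_length R M (?P i) + 1"
          using Suc by (intro add_right_mono) simp
        also note strict
        finally show ?case .
      qed
      from this[of k] have "enat (j + k) \<le> submodule_length R M (?P k)"
        by simp
      also have "\<dots> \<le> enat m"
        using M.submodule_length_mono[OF P B, of k] enat by auto
      finally show "enat k \<le> enat (m - j)"
        by simp
    qed
    then have "?l B \<le> enat j + enat (m - j)"
      unfolding j(1) by (rule add_left_mono)
    then show ?thesis
      using enat j by simp
  qed simp
qed

end


section \<open>Covers in the lattice of submodules\<close>

lemma (in module) annihilator_ideal:
  assumes "submodule D R M" "e \<in> carrier M"
  shows "ideal {r \<in> carrier R. r \<odot>\<^bsub>M\<^esub> e \<in> D} R"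
proof (rule idealI)
  show "ring R" ..
  show "subgroup {r \<in> carrier R. r \<odot>\<^bsub>M\<^esub> e \<in> D} (add_monoid R)"
  proof (rule R.add.subgroupI)
    show "{r \<in> carrier R. r \<odot>\<^bsub>M\<^esub> e \<in> D} \<noteq> {}"
      using assms by (auto simp: submodule_iff intro!: exI[of _ "\<zero>\<^bsub>R\<^esub>"])
  next
    fix a assume "a \<in> {r \<in> carrier R. r \<odot>\<^bsub>M\<^esub> e \<in> D}"
    then show "\<ominus>\<^bsub>R\<^esub> a \<in> {r \<in> carrier R. r \<odot>\<^bsub>M\<^esub> e \<in> D}"
      using assms submoduleE(3)[OF assms(1)] by (auto simp: smult_l_minus)
  next
    fix a b
    assume "a \<in> {r \<in> carrier R. r \<odot>\<^bsub>M\<^esub> e \<in> D}" "b \<in> {r \<in> carrier R. r \<odot>\<^bsub>M\<^esub> e \<in> D}"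
    then show "a \<oplus>\<^bsub>R\<^esub> b \<in> {r \<in> carrier R. r \<odot>\<^bsub>M\<^esub> e \<in> D}"
      using assms by (auto simp: submodule_iff smult_l_distr)
  qed auto
  show l: "x \<otimes>\<^bsub>R\<^esub> a \<in> {r \<in> carrier R. r \<odot>\<^bsub>M\<^esub> e \<in> D}"
    if "a \<in> {r \<in> carrier R. r \<odot>\<^bsub>M\<^esub> e \<in> D}" "x \<in> carrier R" for a x
    using that assms by (auto simp: submodule_iff smult_assoc1)
  show "a \<otimes>\<^bsub>R\<^esub> x \<in> {r \<in> carrier R. r \<odot>\<^bsub>M\<^esub> e \<in> D}"
    if "a \<in> {r \<in> carrier R. r \<odot>\<^bsub>M\<^esub> e \<in> D}" "x \<in> carrier R" for a x
    using l[OF that] that by (simp add: R.m_comm)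
qed

lemma (in module) submodule_adjoin:
  assumes D: "submodule D R M" and e: "e \<in> carrier M"
  shows "submodule {d \<oplus>\<^bsub>M\<^esub> r \<odot>\<^bsub>M\<^esub> e | d r. d \<in> D \<and> r \<in> carrier R} R M"
    and "D \<subseteq> {d \<oplus>\<^bsub>M\<^esub> r \<odot>\<^bsub>M\<^esub> e | d r. d \<in> D \<and> r \<in> carrier R}"
    and "e \<in> {d \<oplus>\<^bsub>M\<^esub> r \<odot>\<^bsub>M\<^esub> e | d r. d \<in> D \<and> r \<in> carrier R}"
proof -
  let ?E = "{d \<oplus>\<^bsub>M\<^esub> r \<odot>\<^bsub>M\<^esub> e | d r. d \<in> D \<and> r \<in> carrier R}"
  have sub: "d \<in> carrier M" if "d \<in> D" for d
    using that D by (auto simp: submodule_iff)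
  show D_sub: "D \<subseteq> ?E"
  proof
    fix d assume "d \<in> D"
    then have "d = d \<oplus>\<^bsub>M\<^esub> \<zero>\<^bsub>R\<^esub> \<odot>\<^bsub>M\<^esub> e"
      using sub e by simp
    then show "d \<in> ?E"
      using \<open>d \<in> D\<close> by blast
  qed
  have "e = \<zero>\<^bsub>M\<^esub> \<oplus>\<^bsub>M\<^esub> \<one>\<^bsub>R\<^esub> \<odot>\<^bsub>M\<^esub> e" "\<zero>\<^bsub>M\<^esub> \<in> D"
    using e D by (auto simp: submodule_iff)
  then show "e \<in> ?E"
    by blast
  show "submodule ?E R M"
    unfolding submodule_iff
  proof (intro conjI ballI)
    show "?E \<subseteq> carrier M"
      using sub e by auto
    show "\<zero>\<^bsub>M\<^esub> \<in> ?E"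
      using D_sub D by (auto simp: submodule_iff)
    show "x \<oplus>\<^bsub>M\<^esub> y \<in> ?E" if xy: "x \<in> ?E" "y \<in> ?E" for x y
    proof -
      obtain d r d' r' where *: "x = d \<oplus>\<^bsub>M\<^esub> r \<odot>\<^bsub>M\<^esub> e" "y = d' \<oplus>\<^bsub>M\<^esub> r' \<odot>\<^bsub>M\<^esub> e"
        "d \<in> D" "d' \<in> D" "r \<in> carrier R" "r' \<in> carrier R"
        using xy by auto
      then have "x \<oplus>\<^bsub>M\<^esub> y = (d \<oplus>\<^bsub>M\<^esub> d') \<oplus>\<^bsub>M\<^esub> (r \<oplus>\<^bsub>R\<^esub> r') \<odot>\<^bsub>M\<^esub> e"
        using sub e by (simp add: smult_l_distr M.add.m_ac)
      moreover have "d \<oplus>\<^bsub>M\<^esub> d' \<in> D" "r \<oplus>\<^bsub>R\<^esub> r' \<in> carrier R"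
        using * D by (auto simp: submodule_iff)
      ultimately show ?thesis
        by blast
    qed
    show "s \<odot>\<^bsub>M\<^esub> x \<in> ?E" if sx: "s \<in> carrier R" "x \<in> ?E" for s x
    proof -
      obtain d r where *: "x = d \<oplus>\<^bsub>M\<^esub> r \<odot>\<^bsub>M\<^esub> e" "d \<in> D" "r \<in> carrier R"
        using sx by auto
      then have "s \<odot>\<^bsub>M\<^esub> x = s \<odot>\<^bsub>M\<^esub> d \<oplus>\<^bsub>M\<^esub> (s \<otimes>\<^bsub>R\<^esub> r) \<odot>\<^bsub>M\<^esub> e"
        using sub e sx by (simp add: smult_r_distr smult_assoc1)
      moreover have "s \<odot>\<^bsub>M\<^esub> d \<in> D" "s \<otimes>\<^bsub>R\<^esub> r \<in> carrier R"
        using * D sx by (auto simp: submodule_iff)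
      ultimately show ?thesis
        by blast
    qed
  qed
qed

text \<open>
  The case that \<open>E / D\<close> is simple, expressed without quotient modules.
\<close>

definition covers :: "('a, 'c) ring_scheme \<Rightarrow> ('a, 'm, 'd) module_scheme \<Rightarrow> 'm set \<Rightarrow> 'm set \<Rightarrow> bool"
  where "covers R M D E \<longleftrightarrow> submodule D R M \<and> submodule E R M \<and> D \<subset> E \<and>
    (\<forall>X. submodule X R M \<longrightarrow> D \<subseteq> X \<longrightarrow> X \<subseteq> E \<longrightarrow> X = D \<or> X = E)"

lemma (in module) cover_adjoin:
  assumes "covers R M D E" "e \<in> E" "e \<notin> D"
  shows "E = {d \<oplus>\<^bsub>M\<^esub> r \<odot>\<^bsub>M\<^esub> e | d r. d \<in> D \<and> r \<in> carrier R}" (is "E = ?S")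
proof -
  have DE: "submodule D R M" "submodule E R M" "D \<subset> E"
    using assms(1) by (auto simp: covers_def)
  have e: "e \<in> carrier M"
    using DE(2) assms(2) by (auto simp: submodule_iff)
  note S = submodule_adjoin[OF DE(1) e]
  have "?S \<subseteq> E"
  proof clarify
    fix d r assume "d \<in> D" "r \<in> carrier R"
    then have "d \<in> E" "r \<odot>\<^bsub>M\<^esub> e \<in> E"
      using DE(2,3) assms(2) by (auto simp: submodule_iff)
    then show "d \<oplus>\<^bsub>M\<^esub> r \<odot>\<^bsub>M\<^esub> e \<in> E"
      using DE(2) by (simp add: submodule_iff)
  qed
  moreover have "?S \<noteq> D"
    using S(3) assms(3) by blast
  moreover have "?S = D \<or> ?S = E"
    using assms(1) S(1,2) \<open>?S \<subseteq> E\<close> by (simp add: covers_def)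
  ultimately show ?thesis
    by simp
qed

text \<open>
  A simple module generated by \<open>e\<close> is \<open>R\<close> modulo a maximal ideal. Directly: if \<open>j\<close> does not annihilate \<open>e\<close>
  modulo \<open>D\<close>, then \<open>j e\<close> generates \<open>E\<close> over \<open>D\<close>, so \<open>e = d + r j e\<close>, and \<open>1 - r j\<close> annihilates \<open>e\<close>.
\<close>

lemma (in module) cover_annihilator_maximal:
  assumes cov: "covers R M D E" "e \<in> E" "e \<notin> D"
  shows "maximalideal {r \<in> carrier R. r \<odot>\<^bsub>M\<^esub> e \<in> D} R" (is "maximalideal ?J R")
proof (rule maximalidealI)
  have DE: "submodule D R M" "submodule E R M"
    using assms(1) by (auto simp: covers_def)
  have e: "e \<in> carrier M"
    using DE(2) assms(2) by (auto simp: submodule_iff)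
  show "ideal ?J R"
    by (rule annihilator_ideal[OF DE(1) e])
  show "carrier R \<noteq> ?J"
  proof
    assume "carrier R = ?J"
    then have "\<one>\<^bsub>R\<^esub> \<in> ?J"
      using R.one_closed by (rule subst)
    then show False
      using assms(3) e by simp
  qed
  fix J assume J: "ideal J R" "?J \<subseteq> J" "J \<subseteq> carrier R"
  interpret J: ideal J R by (rule J)
  show "J = ?J \<or> J = carrier R"
  proof (rule disjCI)
    assume "J \<noteq> carrier R"
    have "J \<subseteq> ?J"
    proof (rule ccontr)
      assume "\<not> J \<subseteq> ?J"
      then obtain j where j: "j \<in> J" "j \<in> carrier R" "j \<odot>\<^bsub>M\<^esub> e \<notin> D"
        using J(3) by auto
      moreover have "j \<odot>\<^bsub>M\<^esub> e \<in> E"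
        using DE(2) j assms(2) by (auto simp: submodule_iff)
      ultimately have "e \<in> {d \<oplus>\<^bsub>M\<^esub> r \<odot>\<^bsub>M\<^esub> (j \<odot>\<^bsub>M\<^esub> e) | d r. d \<in> D \<and> r \<in> carrier R}"
        using cover_adjoin[OF cov(1), of "j \<odot>\<^bsub>M\<^esub> e"] assms(2) by simp
      then obtain d r where dr: "e = d \<oplus>\<^bsub>M\<^esub> r \<odot>\<^bsub>M\<^esub> (j \<odot>\<^bsub>M\<^esub> e)" "d \<in> D" "r \<in> carrier R"
        by auto
      have d: "d \<in> carrier M"
        using DE(1) dr(2) by (auto simp: submodule_iff)
      define u where "u = \<one>\<^bsub>R\<^esub> \<ominus>\<^bsub>R\<^esub> r \<otimes>\<^bsub>R\<^esub> j"
      have u: "u \<in> carrier R"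
        using dr j by (simp add: u_def)
      have "u \<odot>\<^bsub>M\<^esub> e = e \<ominus>\<^bsub>M\<^esub> r \<odot>\<^bsub>M\<^esub> (j \<odot>\<^bsub>M\<^esub> e)"
        using dr(3) j e by (simp add: u_def a_minus_def smult_l_distr smult_l_minus smult_assoc1)
      also have "\<dots> = d"
        using dr(3) j e d by (subst (1) dr(1)) (simp add: a_minus_def M.a_assoc M.r_neg)
      finally have "u \<in> ?J"
        using dr(2) u by simp
      then have "u \<in> J"
        using J(2) by blast
      moreover have "r \<otimes>\<^bsub>R\<^esub> j \<in> J"
        using j(1) dr(3) by (rule J.I_l_closed)
      ultimately have "u \<oplus>\<^bsub>R\<^esub> r \<otimes>\<^bsub>R\<^esub> j \<in> J"
        by (rule J.a_closed)
      moreover have "u \<oplus>\<^bsub>R\<^esub> r \<otimes>\<^bsub>R\<^esub> j = \<one>\<^bsub>R\<^esub>"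
        using dr(3) j(2) by (simp add: u_def a_minus_def R.a_assoc R.l_neg)
      ultimately show False
        using J.one_imp_carrier \<open>J \<noteq> carrier R\<close> by simp
    qed
    then show "J = ?J"
      using J(2) by blast
  qed
qed


section \<open>Ideals as submodules of the ring\<close>

lemma regular_module_simps [simp]:
  "carrier (regular_module R) = carrier R"
  "\<zero>\<^bsub>regular_module R\<^esub> = \<zero>\<^bsub>R\<^esub>"
  "x \<oplus>\<^bsub>regular_module R\<^esub> y = x \<oplus>\<^bsub>R\<^esub> y"
  "x \<odot>\<^bsub>regular_module R\<^esub> y = x \<otimes>\<^bsub>R\<^esub> y"
  by (simp_all add: regular_module_def)

lemma (in cring) module_regular_module: "module R (regular_module R)"
proof (rule moduleI)
  show "abelian_group (regular_module R)"
  proof (rule abelian_groupI)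
    show "\<exists>y\<in>carrier (regular_module R). y \<oplus>\<^bsub>regular_module R\<^esub> x = \<zero>\<^bsub>regular_module R\<^esub>"
      if "x \<in> carrier (regular_module R)" for x
      using that l_neg[of x] by (auto intro!: bexI[of _ "\<ominus> x"])
  qed (simp_all add: a_ac)
qed (simp_all add: l_distr r_distr m_assoc cring_axioms)

lemma (in cring) submodule_regular_module_iff:
  "submodule I R (regular_module R) \<longleftrightarrow> ideal I R"
proof
  interpret reg: module R "regular_module R"
    by (rule module_regular_module)
  show "submodule I R (regular_module R)" if "ideal I R"
  proof -
    interpret I: ideal I R by (rule that)
    show ?thesis
      by (auto simp: reg.submodule_iff I.I_l_closed)
  qed
  show "ideal I R" if I: "submodule I R (regular_module R)"
  proof -
    have c: "I \<subseteq> carrier R"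
      using I by (auto simp: reg.submodule_iff)
    show ?thesis
    proof (rule idealI)
      show "ring R" ..
      show "x \<otimes> a \<in> I" if "a \<in> I" "x \<in> carrier R" for a x
        using that I by (auto simp: reg.submodule_iff)
      then show "a \<otimes> x \<in> I" if "a \<in> I" "x \<in> carrier R" for a x
        using that c m_comm[of a x] by auto
      show "subgroup I (add_monoid R)"
      proof (rule add.subgroupI)
        fix a assume a: "a \<in> I"
        then have "(\<ominus> \<one>) \<otimes> a \<in> I"
          using I by (auto simp: reg.submodule_iff)
        then show "\<ominus> a \<in> I"
          using a c by (simp add: l_minus subset_iff)
      qed (use I in \<open>auto simp: reg.submodule_iff\<close>)
    qed
  qed
qed

lemma (in cring) ring_length_eq:
  "ring_length R = the_enat (submodule_length R (regular_module R) (carrier R))"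
  by (simp add: ring_length_def regular_module_def)


section \<open>Local Artinian rings\<close>

context local_artinian_ring
begin

lemma maximal_subset: "\<mm> \<subseteq> carrier R"
  using maximal by (auto simp: maximalideal_def ideal_def additive_subgroup.a_subset)

lemma wf_ideals: "wf {(I, J). ideal I R \<and> I \<subset> J}"
  unfolding wf_iff_no_infinite_down_chain
proof clarify
  fix I :: "nat \<Rightarrow> 'a set"
  assume *: "\<forall>i. (I (Suc i), I i) \<in> {(I, J). ideal I R \<and> I \<subset> J}"
  then obtain N where "\<forall>k\<ge>N. I (Suc k) = I (Suc N)"
    using descending_chain[of "\<lambda>k. I (Suc k)"] by auto
  then have "I (Suc (Suc N)) = I (Suc N)"
    by (meson le_Suc_eq order_refl)
  then show False
    using * by auto
qed

lemma cover_annihilator: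
  assumes "module R M" "covers R M D E" "e \<in> E" "e \<notin> D"
  shows "{r \<in> carrier R. r \<odot>\<^bsub>M\<^esub> e \<in> D} = \<mm>"
  by (rule unique_maximal[OF module.cover_annihilator_maximal[OF assms]])

text \<open>
  A minimal nonzero ideal below \<open>I\<close> covers the zero ideal, so the annihilator of each of its nonzero elements is the
  maximal ideal.
\<close>

lemma nonzero_ideal_meets_socle:
  assumes "ideal I R" "I \<noteq> {\<zero>}"
  obtains e where "e \<in> I" "e \<noteq> \<zero>" "e \<in> socle R \<mm>"
proof -
  interpret reg: module R "regular_module R"
    by (rule module_regular_module)
  let ?Q = "{J. ideal J R \<and> J \<subseteq> I \<and> J \<noteq> {\<zero>}}"
  have "I \<in> ?Q"
    using assms by auto
  then obtain J where J: "J \<in> ?Q" and min: "\<And>K. (K, J) \<in> {(I, J). ideal I R \<and> I \<subset> J} \<Longrightarrow> K \<notin> ?Q"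
    by (rule wfE_min[OF wf_ideals]) blast
  interpret J: ideal J R
    using J by simp
  have zero: "ideal {\<zero>} R"
    using reg.zero_submodule by (simp add: submodule_regular_module_iff)
  have "\<zero> \<in> J"
    by simp
  then obtain e where e: "e \<in> J" "e \<noteq> \<zero>"
    using J by blast
  have "X = {\<zero>} \<or> X = J" if "ideal X R" "{\<zero>} \<subseteq> X" "X \<subseteq> J" for X
    using min[of X] that J by auto
  then have "covers R (regular_module R) {\<zero>} J"
    unfolding covers_def using e zero J \<open>\<zero> \<in> J\<close> by (auto simp: submodule_regular_module_iff)
  then have "{r \<in> carrier R. r \<otimes> e \<in> {\<zero>}} = \<mm>"
    using cover_annihilator[OF module_regular_module, of "{\<zero>}" J e] e by simp
  then have "e \<in> socle R \<mm>"
    using J.a_Hcarr[OF e(1)] by (auto simp: socle_def)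
  then show thesis
    using that[of e] e J by auto
qed

text \<open>
  If the powers of \<open>a\<close> generate the same ideal from some \<open>b = a\<^sup>k\<close> on, then \<open>b = t b\<^sup>2\<close>, and multiplication by
  \<open>b\<close> is injective on the ideal generated by \<open>b\<close>. If that ideal were nonzero it would contain a nonzero
  element of the socle, which \<open>a\<close> and hence \<open>b\<close> kills.
\<close>

lemma maximal_ideal_nilpotent:
  assumes "a \<in> \<mm>"
  obtains k :: nat where "a [^] k = \<zero>"
proof (rule ccontr)
  assume not_nil: "\<not> thesis"
  have a: "a \<in> carrier R"
    using assms maximal_subset by auto
  have PIdl_mono: "PIdl (a [^] Suc k) \<subseteq> PIdl (a [^] k)" for k :: nat
  proof -
    have "a [^] Suc k = a \<otimes> a [^] k"
      using a by (simp add: m_comm)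
    then have "a [^] Suc k \<in> PIdl (a [^] k)"
      using a by (auto simp: cgenideal_def)
    then show ?thesis
      using a by (intro cgenideal_minimal cgenideal_ideal) auto
  qed
  have "\<exists>N. \<forall>k\<ge>N::nat. PIdl (a [^] k) = PIdl (a [^] N)"
    by (rule descending_chain[of "\<lambda>k::nat. PIdl (a [^] k)", OF cgenideal_ideal PIdl_mono]) (use a in simp)
  then obtain N where N: "\<And>k::nat. k \<ge> N \<Longrightarrow> PIdl (a [^] k) = PIdl (a [^] N)"
    by metis
  \<comment> \<open>One more than the stabilisation index, so that \<open>a\<close> divides \<open>b\<close>.\<close>
  define k where "k = Suc N"
  define b where "b = a [^] k"
  have b: "b \<in> carrier R"
    using a by (simp add: b_def)
  have "PIdl (a [^] k) = PIdl (a [^] (k + k))"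
    using N[of k] N[of "k + k"] by (simp add: k_def)
  then have "b \<in> PIdl (b \<otimes> b)"
    using cgenideal_self[OF b] a by (simp add: b_def nat_pow_mult)
  then obtain t where t: "t \<in> carrier R" "b = t \<otimes> (b \<otimes> b)"
    by (auto simp: cgenideal_def)
  have "b \<noteq> \<zero>"
    using not_nil that[of k] by (auto simp: b_def)
  then have "PIdl b \<noteq> {\<zero>}"
    using cgenideal_self[OF b] by auto
  then obtain e where e: "e \<in> PIdl b" "e \<noteq> \<zero>" "e \<in> socle R \<mm>"
    using nonzero_ideal_meets_socle cgenideal_ideal[OF b] by metis
  obtain r where r: "r \<in> carrier R" "e = r \<otimes> b"
    using e(1) by (auto simp: cgenideal_def)
  have ec: "e \<in> carrier R" and ae: "a \<otimes> e = \<zero>"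
    using e(3) assms by (auto simp: socle_def)
  have "b = a [^] N \<otimes> a"
    by (simp add: b_def k_def)
  then have be: "b \<otimes> e = \<zero>"
    using a ec ae by (simp add: m_assoc)
  have "e = r \<otimes> (t \<otimes> (b \<otimes> b))"
    using r(2) t(2) by simp
  also have "\<dots> = t \<otimes> (b \<otimes> e)"
    using r t(1) b by (simp add: m_ac)
  finally show False
    using be t(1) e(2) by simp
qed

end

section \<open>Finite length of a Frobenius ring\<close>

context frobenius_ring
begin

text \<open>
  The socle is isomorphic to the residue field, in which every nonzero element generates everything.
\<close>

lemma socle_generated:
  assumes "x \<in> socle R \<mm>" "x \<noteq> \<zero>" "y \<in> socle R \<mm>"
  obtains t where "t \<in> carrier R" "y = t \<otimes> x"
proof -
  interpret m: maximalideal \<mm> R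
    by (rule maximal)
  interpret Q: field "R Quot \<mm>"
    by (rule m.quotient_is_field) (rule cring_axioms)
  obtain f where bij: "bij_betw f (socle R \<mm>) (carrier (R Quot \<mm>))"
    and add: "\<And>x y. x \<in> socle R \<mm> \<Longrightarrow> y \<in> socle R \<mm> \<Longrightarrow> f (x \<oplus> y) = f x \<oplus>\<^bsub>R Quot \<mm>\<^esub> f y"
    and smult: "\<And>r x. r \<in> carrier R \<Longrightarrow> x \<in> socle R \<mm> \<Longrightarrow> f (r \<otimes> x) = (\<mm> +> r) \<otimes>\<^bsub>R Quot \<mm>\<^esub> f x"
    using socle_iso unfolding module_isomorphic_def quotient_module_def
    by auto
  have closed: "f z \<in> carrier (R Quot \<mm>)" if "z \<in> socle R \<mm>" for z
    using bij that by (auto simp: bij_betw_def)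
  have zero: "\<zero> \<in> socle R \<mm>"
    using maximal_subset by (auto simp: socle_def)
  have "f \<zero> \<oplus>\<^bsub>R Quot \<mm>\<^esub> f \<zero> = f \<zero>"
    using add[OF zero zero] by simp
  then have "f \<zero> = \<zero>\<^bsub>R Quot \<mm>\<^esub>"
    using closed[OF zero] by (metis Q.add.r_cancel_one')
  then have "f x \<noteq> \<zero>\<^bsub>R Quot \<mm>\<^esub>"
    using bij assms(1,2) zero unfolding bij_betw_def inj_on_def by metis
  then have fx: "f x \<in> Units (R Quot \<mm>)"
    using closed[OF assms(1)] by (simp add: Q.field_Units)
  define T where "T = f y \<otimes>\<^bsub>R Quot \<mm>\<^esub> inv\<^bsub>R Quot \<mm>\<^esub> f x"
  have "T \<in> carrier (R Quot \<mm>)"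
    using fx closed[OF assms(3)] by (simp add: T_def)
  then obtain t where t: "t \<in> carrier R" "T = \<mm> +> t"
    by (auto simp: FactRing_def A_RCOSETS_def')
  have tx: "t \<otimes> x \<in> socle R \<mm>"
    unfolding socle_def
  proof clarify
    have x: "x \<in> carrier R" "\<forall>a\<in>\<mm>. a \<otimes> x = \<zero>"
      using assms(1) by (auto simp: socle_def)
    have "a \<otimes> (t \<otimes> x) = \<zero>" if "a \<in> \<mm>" for a
    proof -
      have "a \<in> carrier R"
        using that maximal_subset by blast
      then show ?thesis
        using that x t(1) m_lcomm[of a t x] by simp
    qed
    then show "t \<otimes> x \<in> carrier R \<and> (\<forall>a\<in>\<mm>. a \<otimes> (t \<otimes> x) = \<zero>)"
      using t(1) x(1) by simp
  qed
  have "f (t \<otimes> x) = T \<otimes>\<^bsub>R Quot \<mm>\<^esub> f x"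
    using smult[OF t(1) assms(1)] t(2) by simp
  also have "\<dots> = f y"
    using fx closed[OF assms(1)] closed[OF assms(3)] by (simp add: T_def Q.m_assoc)
  finally have "t \<otimes> x = y"
    using bij tx assms(3) by (auto simp: bij_betw_def inj_on_def)
  then show thesis
    using that t(1) by blast
qed

lemma length_in_socle:
  assumes I: "ideal I R" "I \<subseteq> socle R \<mm>"
  shows "submodule_length R (regular_module R) I \<le> 1"
proof -
  interpret reg: module R "regular_module R"
    by (rule module_regular_module)
  have "enat k \<le> 1" if N: "submodule_chain R (regular_module R) N k" "N k \<subseteq> I" for N k
  proof (rule ccontr)
    assume "\<not> enat k \<le> 1"
    then have "2 \<le> k"
      by (simp add: one_enat_def)
    then have ideals: "ideal (N 0) R" "ideal (N 1) R" and strict: "N 0 \<subset> N 1" "N 1 \<subset> N 2"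
      using N(1) by (auto simp: submodule_chain_def submodule_regular_module_iff numeral_2_eq_2)
    have soc: "N 2 \<subseteq> socle R \<mm>"
      using submodule_chain_mono[OF N(1) \<open>2 \<le> k\<close>] N(2) I(2) by auto
    interpret N0: ideal "N 0" R by (rule ideals)
    interpret N1: ideal "N 1" R by (rule ideals)
    obtain x where "x \<in> N 1" "x \<notin> N 0"
      using strict(1) by blast
    then have x: "x \<in> N 1" "x \<noteq> \<zero>"
      using N0.zero_closed by blast+
    have "N 2 \<subseteq> N 1"
    proof
      fix y assume "y \<in> N 2"
      then obtain t where "t \<in> carrier R" "y = t \<otimes> x"
        using socle_generated[of x y] x strict(2) soc by auto
      then show "y \<in> N 1"
        using x(1) N1.I_l_closed by auto
    qed
    then show False
      using strict(2) by auto
  qed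
  then show ?thesis
    using I by (intro reg.submodule_length_le) (auto simp: submodule_regular_module_iff)
qed

text \<open>
  By the descending chain condition it may be assumed that every ideal properly below \<open>W\<close> has finite length.
  If some \<open>a\<close> in the maximal ideal does not annihilate \<open>W\<close>, then multiplication by \<open>a\<close> on \<open>W\<close> has a kernel and
  an image that are both proper in \<open>W\<close>, the image because \<open>a\<close> is nilpotent, and the lengths of the two add up
  to that of \<open>W\<close>. If there is no such \<open>a\<close>, then \<open>W\<close> lies in the socle and has length at most one.
\<close>

lemma ideal_length_finite:
  assumes "ideal W R"
  shows "submodule_length R (regular_module R) W \<noteq> \<infinity>"
  using wf_ideals assms
proof (induction W rule: wf_induct_rule)
  case (less W)
  interpret reg: module R "regular_module R"
    by (rule module_regular_module)
  interpret W: ideal W R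
    by (rule less.prems)
  have W: "submodule W R (regular_module R)"
    using less.prems by (simp add: submodule_regular_module_iff)
  show ?case
  proof (cases "W \<subseteq> socle R \<mm>")
    case True
    then show ?thesis
      using length_in_socle[OF less.prems True] by (metis infinity_ileE one_enat_def)
  next
    case False
    then obtain a w where a: "a \<in> \<mm>" and w: "w \<in> W" "a \<otimes> w \<noteq> \<zero>"
      using W.a_Hcarr by (auto simp: socle_def)
    have ac: "a \<in> carrier R"
      using a maximal_subset by auto
    have hom: "(\<lambda>x. a \<otimes> x) \<in> module_hom R (regular_module R) (regular_module R)"
      using ac by (auto simp: module_hom_def r_distr m_lcomm)
    note hom = module_regular_module module_regular_module hom
    have "ideal ((\<lambda>x. a \<otimes> x) ` W) R"
      using submodule_image[OF hom W] by (simp add: submodule_regular_module_iff)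
    moreover have "(\<lambda>x. a \<otimes> x) ` W \<subset> W"
    proof (rule ccontr)
      assume "\<not> ?thesis"
      moreover have "(\<lambda>x. a \<otimes> x) ` W \<subseteq> W"
        using ac W.I_l_closed by auto
      ultimately have eq: "(\<lambda>x. a \<otimes> x) ` W = W"
        by blast
      have "\<exists>y\<in>W. w = a [^] k \<otimes> y" for k :: nat
      proof (induction k)
        case 0
        then show ?case
          using w(1) W.a_Hcarr by (intro bexI[of _ w]) auto
      next
        case (Suc k)
        then obtain y where y: "y \<in> W" "w = a [^] k \<otimes> y"
          by auto
        then obtain z where "z \<in> W" "y = a \<otimes> z"
          using eq by (metis imageE)
        then show ?case
          using y ac W.a_Hcarr by (intro bexI[of _ z]) (auto simp: m_assoc)
      qed
      moreover obtain k :: nat where "a [^] k = \<zero>"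
        using maximal_ideal_nilpotent[OF a] by auto
      ultimately have "w = \<zero>"
        using W.a_Hcarr by (metis l_null)
      then show False
        using w(2) ac by simp
    qed
    ultimately have image: "submodule_length R (regular_module R) ((\<lambda>x. a \<otimes> x) ` W) \<noteq> \<infinity>"
      using less.IH by simp
    have "ideal {x \<in> W. a \<otimes> x = \<zero>} R"
      using submodule_kernel[OF hom W] by (simp add: submodule_regular_module_iff)
    then have kernel: "submodule_length R (regular_module R) {x \<in> W. a \<otimes> x = \<zero>} \<noteq> \<infinity>"
      using w by (intro less.IH) auto
    show ?thesis
      using image kernel submodule_length_kernel_image[OF hom W] by auto
  qed
qed

lemma ring_length_enat:
  "submodule_length R (regular_module R) (carrier R) = enat (ring_length R)"
  using ideal_length_finite[OF oneideal] by (auto simp: ring_length_eq)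

end


section \<open>Codes and the dot product\<close>

lemma free_module_simps [simp]:
  "carrier (free_module R n) = {1..n} \<rightarrow>\<^sub>E carrier R"
  "\<zero>\<^bsub>free_module R n\<^esub> = (\<lambda>i\<in>{1..n}. \<zero>\<^bsub>R\<^esub>)"
  "v \<oplus>\<^bsub>free_module R n\<^esub> w = (\<lambda>i\<in>{1..n}. v i \<oplus>\<^bsub>R\<^esub> w i)"
  "r \<odot>\<^bsub>free_module R n\<^esub> v = (\<lambda>i\<in>{1..n}. r \<otimes>\<^bsub>R\<^esub> v i)"
  by (simp_all add: free_module_def)

text \<open>
  The bounds are written with \<open>Suc 0\<close> because that is the form the simplifier gives to membership in \<open>{1..n}\<close>.
\<close>

lemma code_coordinate [simp]:
  "v \<in> {Suc 0..n} \<rightarrow>\<^sub>E carrier R \<Longrightarrow> Suc 0 \<le> i \<Longrightarrow> i \<le> n \<Longrightarrow> v i \<in> carrier R"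
  by auto

lemma code_eqI:
  assumes "v \<in> carrier (free_module R n)" "w \<in> carrier (free_module R n)"
    and "\<And>i. i \<in> {1..n} \<Longrightarrow> v i = w i"
  shows "v = w"
proof (rule extensionalityI)
  show "v \<in> extensional {1..n}" "w \<in> extensional {1..n}"
    using assms(1,2) by (simp_all add: PiE_def)
qed (rule assms(3))

context cring
begin

lemma module_free_module: "module R (free_module R n)"
proof (rule moduleI)
  show "abelian_group (free_module R n)"
  proof (rule abelian_groupI)
    fix v assume v: "v \<in> carrier (free_module R n)"
    have "(\<lambda>i\<in>{1..n}. \<ominus> v i) \<oplus>\<^bsub>free_module R n\<^esub> v = \<zero>\<^bsub>free_module R n\<^esub>"
      using v by (auto simp: fun_eq_iff l_neg)
    moreover have "(\<lambda>i\<in>{1..n}. \<ominus> v i) \<in> carrier (free_module R n)"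
      using v by auto
    ultimately show "\<exists>w\<in>carrier (free_module R n). w \<oplus>\<^bsub>free_module R n\<^esub> v = \<zero>\<^bsub>free_module R n\<^esub>"
      by blast
  qed (auto simp: a_ac intro!: code_eqI[of _ R n])
qed (auto simp: l_distr r_distr m_assoc cring_axioms intro!: code_eqI[of _ R n])

lemma dot_closed:
  assumes "v \<in> carrier (free_module R n)" "w \<in> carrier (free_module R n)"
  shows "dot R n v w \<in> carrier R"
  using assms by (auto simp: dot_def intro!: finsum_closed)

lemma dot_commute:
  assumes "v \<in> carrier (free_module R n)" "w \<in> carrier (free_module R n)"
  shows "dot R n v w = dot R n w v"
  unfolding dot_def using assms
  by (intro add.finprod_cong') (auto intro!: m_comm)

lemma dot_module_hom:
  assumes "w \<in> carrier (free_module R n)"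
  shows "(\<lambda>v. dot R n v w) \<in> module_hom R (free_module R n) (regular_module R)"
  unfolding module_hom_def
proof (intro CollectI conjI ballI)
  show "(\<lambda>v. dot R n v w) \<in> carrier (free_module R n) \<rightarrow> carrier (regular_module R)"
    using assms dot_closed by auto
next
  fix u v assume uv: "u \<in> carrier (free_module R n)" "v \<in> carrier (free_module R n)"
  have "dot R n (u \<oplus>\<^bsub>free_module R n\<^esub> v) w = (\<Oplus>i\<in>{1..n}. u i \<otimes> w i \<oplus> v i \<otimes> w i)"
    unfolding dot_def using uv assms
    by (intro add.finprod_cong') (auto simp: l_distr)
  also have "\<dots> = dot R n u w \<oplus> dot R n v w"
    unfolding dot_def using uv assms by (intro finsum_addf) auto
  finally show "dot R n (u \<oplus>\<^bsub>free_module R n\<^esub> v) w =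
      dot R n u w \<oplus>\<^bsub>regular_module R\<^esub> dot R n v w"
    by simp
next
  fix r v assume rv: "r \<in> carrier R" "v \<in> carrier (free_module R n)"
  have "dot R n (r \<odot>\<^bsub>free_module R n\<^esub> v) w = (\<Oplus>i\<in>{1..n}. r \<otimes> (v i \<otimes> w i))"
    unfolding dot_def using rv assms
    by (intro add.finprod_cong') (auto simp: m_assoc)
  also have "\<dots> = r \<otimes> dot R n v w"
    unfolding dot_def using rv assms by (intro finsum_rdistr[symmetric]) auto
  finally show "dot R n (r \<odot>\<^bsub>free_module R n\<^esub> v) w = r \<odot>\<^bsub>regular_module R\<^esub> dot R n v w"
    by simp
qed

lemma dot_add_right:
  assumes "u \<in> carrier (free_module R n)" "v \<in> carrier (free_module R n)" "w \<in> carrier (free_module R n)"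
  shows "dot R n u (v \<oplus>\<^bsub>free_module R n\<^esub> w) = dot R n u v \<oplus> dot R n u w"
proof -
  interpret F: module R "free_module R n" by (rule module_free_module)
  show ?thesis
    using module_hom_add[OF module_free_module module_regular_module dot_module_hom[OF assms(1)], of v w] assms
      dot_commute[OF assms(1,2)] dot_commute[OF assms(1,3)] dot_commute[OF assms(1) F.a_closed[OF assms(2,3)]]
    by (simp del: free_module_simps)
qed

lemma dot_smult_right:
  assumes "u \<in> carrier (free_module R n)" "v \<in> carrier (free_module R n)" "r \<in> carrier R"
  shows "dot R n u (r \<odot>\<^bsub>free_module R n\<^esub> v) = r \<otimes> dot R n u v"
proof -
  interpret F: module R "free_module R n" by (rule module_free_module)
  show ?thesis
    using module_hom_smult[OF module_free_module module_regular_module dot_module_hom[OF assms(1)], of r v] assms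
      dot_commute[OF assms(1,2)] dot_commute[OF assms(1) F.smult_closed[OF assms(3,2)]]
    by (simp del: free_module_simps)
qed

lemma dot_smult_left:
  assumes "u \<in> carrier (free_module R n)" "v \<in> carrier (free_module R n)" "r \<in> carrier R"
  shows "dot R n (r \<odot>\<^bsub>free_module R n\<^esub> u) v = r \<otimes> dot R n u v"
  using module_hom_smult[OF module_free_module module_regular_module dot_module_hom[OF assms(2)], of r u] assms
  by (simp del: free_module_simps)

lemma dot_zero_left:
  assumes "v \<in> carrier (free_module R n)"
  shows "dot R n \<zero>\<^bsub>free_module R n\<^esub> v = \<zero>"
  using module_hom_zero[OF module_free_module module_regular_module dot_module_hom[OF assms]]
  by (simp del: free_module_simps)

lemma code_subset: "is_code R n C \<Longrightarrow> C \<subseteq> carrier (free_module R n)"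
  using module.submoduleE(1)[OF module_free_module] .

lemma orthogonal_code_is_code:
  assumes "C \<subseteq> carrier (free_module R n)"
  shows "is_code R n (orthogonal_code R n C)"
proof -
  interpret F: module R "free_module R n" by (rule module_free_module)
  show ?thesis
    unfolding F.submodule_iff
  proof (intro conjI ballI)
    show "orthogonal_code R n C \<subseteq> carrier (free_module R n)"
      by (auto simp: orthogonal_code_def simp del: free_module_simps)
    show "\<zero>\<^bsub>free_module R n\<^esub> \<in> orthogonal_code R n C"
      using assms by (auto simp: orthogonal_code_def dot_zero_left simp del: free_module_simps)
    fix v assume v: "v \<in> orthogonal_code R n C"
    show "v \<oplus>\<^bsub>free_module R n\<^esub> w \<in> orthogonal_code R n C" if "w \<in> orthogonal_code R n C" for w
      using v that assms module_hom_add[OF module_free_module module_regular_module dot_module_hom]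
      by (auto simp: orthogonal_code_def subset_iff simp del: free_module_simps)
  next
    fix r v assume "r \<in> carrier R" "v \<in> orthogonal_code R n C"
    then show "r \<odot>\<^bsub>free_module R n\<^esub> v \<in> orthogonal_code R n C"
      using assms by (auto simp: orthogonal_code_def subset_iff dot_smult_left simp del: free_module_simps)
  qed
qed

definition unit_vector :: "nat \<Rightarrow> nat \<Rightarrow> nat \<Rightarrow> 'a"
  where "unit_vector n i = (\<lambda>j\<in>{1..n}. if i = j then \<one> else \<zero>)"

lemma dot_unit_vector:
  assumes "v \<in> carrier (free_module R n)" "i \<in> {1..n}"
  shows "dot R n v (unit_vector n i) = v i"
proof -
  have "dot R n v (unit_vector n i) = (\<Oplus>j\<in>{1..n}. if i = j then v j else \<zero>)"
    unfolding dot_def using assms by (intro add.finprod_cong') (auto simp: unit_vector_def)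
  also have "\<dots> = v i"
    using assms by (intro add.finprod_singleton) auto
  finally show ?thesis .
qed

lemma orthogonal_code_full:
  "orthogonal_code R n (carrier (free_module R n)) = {\<zero>\<^bsub>free_module R n\<^esub>}"
proof -
  have "v = \<zero>\<^bsub>free_module R n\<^esub>" if v: "v \<in> orthogonal_code R n (carrier (free_module R n))" for v
  proof -
    have vc: "v \<in> carrier (free_module R n)"
      using v by (simp add: orthogonal_code_def)
    have "v i = \<zero>" if i: "i \<in> {1..n}" for i
    proof -
      have "unit_vector n i \<in> carrier (free_module R n)"
        by (auto simp: unit_vector_def)
      then show ?thesis
        using v dot_unit_vector[OF vc i] by (simp add: orthogonal_code_def)
    qed
    then show ?thesis
      using vc by (intro code_eqI[of _ R n]) auto
  qed
  moreover have "\<zero>\<^bsub>free_module R n\<^esub> \<in> orthogonal_code R n (carrier (free_module R n))"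
    using dot_zero_left by (auto simp: orthogonal_code_def)
  ultimately show ?thesis
    by blast
qed

lemma orthogonal_code_zero:
  "orthogonal_code R n {\<zero>\<^bsub>free_module R n\<^esub>} = carrier (free_module R n)"
proof -
  interpret F: module R "free_module R n" by (rule module_free_module)
  show ?thesis
    using dot_zero_left dot_commute[OF _ F.M.zero_closed]
    by (auto simp: orthogonal_code_def simp del: free_module_simps)
qed

lemma supported_code_is_code:
  assumes "is_code R n C"
  shows "is_code R n (supported_code R n C A)"
proof -
  interpret F: module R "free_module R n" by (rule module_free_module)
  have C: "C \<subseteq> carrier (free_module R n)"
    using code_subset[OF assms] .
  show ?thesis
    unfolding F.submodule_iff
  proof (intro conjI ballI)
    show "supported_code R n C A \<subseteq> carrier (free_module R n)"
      using C by (auto simp: supported_code_def)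
    show "\<zero>\<^bsub>free_module R n\<^esub> \<in> supported_code R n C A"
      using assms by (auto simp: supported_code_def supp_def F.submodule_iff)
  next
    fix v w assume "v \<in> supported_code R n C A" "w \<in> supported_code R n C A"
    moreover from this have "v \<oplus>\<^bsub>free_module R n\<^esub> w \<in> C"
      using assms unfolding F.submodule_iff supported_code_def by blast
    ultimately show "v \<oplus>\<^bsub>free_module R n\<^esub> w \<in> supported_code R n C A"
      by (fastforce simp: supported_code_def supp_def)
  next
    fix r v assume "r \<in> carrier R" "v \<in> supported_code R n C A"
    moreover from this have "r \<odot>\<^bsub>free_module R n\<^esub> v \<in> C"
      using assms unfolding F.submodule_iff supported_code_def by blast
    ultimately show "r \<odot>\<^bsub>free_module R n\<^esub> v \<in> supported_code R n C A"
      by (fastforce simp: supported_code_def supp_def)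
  qed
qed

lemma full_code: "is_code R n (carrier (free_module R n))"
  using module.carrier_is_submodule[OF module_free_module] .

lemma coordinate_module_hom:
  assumes "i \<in> {1..n}"
  shows "(\<lambda>v. v i) \<in> module_hom R (free_module R n) (regular_module R)"
  using assms by (auto simp: module_hom_def)

text \<open>
  The coordinate projection onto \<open>B\<close>, with values in the same free module. It is its own adjoint for the dot
  product.
\<close>

definition restrict_support :: "nat \<Rightarrow> nat set \<Rightarrow> (nat \<Rightarrow> 'a) \<Rightarrow> nat \<Rightarrow> 'a"
  where "restrict_support n B v = (\<lambda>i\<in>{1..n}. if i \<in> B then v i else \<zero>)"

lemma restrict_support_module_hom:
  "restrict_support n B \<in> module_hom R (free_module R n) (free_module R n)"
  by (auto simp: module_hom_def restrict_support_def fun_eq_iff)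

lemma supp_restrict_support: "supp R n (restrict_support n B v) \<subseteq> B"
  by (auto simp: supp_def restrict_support_def)

lemma restrict_support_eq_self:
  assumes "v \<in> carrier (free_module R n)" "supp R n v \<subseteq> B"
  shows "restrict_support n B v = v"
  using assms by (intro code_eqI[of _ R n]) (auto simp: supp_def restrict_support_def)

lemma restrict_support_eq_zero:
  "restrict_support n B v = \<zero>\<^bsub>free_module R n\<^esub> \<longleftrightarrow> supp R n v \<subseteq> {1..n} - B"
  by (auto simp: supp_def restrict_support_def fun_eq_iff)

lemma dot_restrict_support:
  assumes "v \<in> carrier (free_module R n)" "w \<in> carrier (free_module R n)"
  shows "dot R n (restrict_support n B v) w = dot R n v (restrict_support n B w)"
  unfolding dot_def using assms
  by (intro add.finprod_cong') (auto simp: restrict_support_def)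

end


section \<open>The length of the orthogonal code\<close>

context frobenius_ring
begin

text \<open>
  Adding a coordinate \<open>i\<close> to \<open>A\<close> adds one copy of \<open>R\<close>: the \<open>i\<close>-th coordinate map is onto \<open>R\<close>, and its kernel is
  the part supported in \<open>A\<close>.
\<close>

lemma supported_code_length:
  assumes "A \<subseteq> {1..n}"
  shows "submodule_length R (free_module R n) (supported_code R n (carrier (free_module R n)) A) =
    enat (card A * ring_length R)"
proof -
  interpret F: module R "free_module R n" by (rule module_free_module)
  let ?S = "supported_code R n (carrier (free_module R n))"
  have S: "is_code R n (?S A)" for A
    by (rule supported_code_is_code[OF full_code])
  have "finite A"
    using assms finite_subset by blast
  then show ?thesis
    using assms
  proof (induction A rule: finite_induct)
    case empty
    have "?S {} = {\<zero>\<^bsub>free_module R n\<^esub>}"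
      by (auto simp: supported_code_def supp_def intro!: code_eqI[of _ R n])
    then show ?case
      using F.submodule_length_zero by (simp add: zero_enat_def)
  next
    case (insert i A)
    then have i: "i \<in> {1..n}"
      by simp
    have kernel: "{v \<in> ?S (insert i A). v i = \<zero>\<^bsub>regular_module R\<^esub>} = ?S A"
      using insert.hyps(2) i by (auto simp: supported_code_def supp_def)
    have image: "(\<lambda>v. v i) ` ?S (insert i A) = carrier R"
    proof
      show "(\<lambda>v. v i) ` ?S (insert i A) \<subseteq> carrier R"
        using i by (auto simp: supported_code_def)
      show "carrier R \<subseteq> (\<lambda>v. v i) ` ?S (insert i A)"
      proof
        fix r assume "r \<in> carrier R"
        then show "r \<in> (\<lambda>v. v i) ` ?S (insert i A)"
          using i by (intro image_eqI[of _ _ "\<lambda>j\<in>{1..n}. if j = i then r else \<zero>"])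
            (auto simp: supported_code_def supp_def)
      qed
    qed
    have "submodule_length R (free_module R n) (?S (insert i A)) =
        enat (card A * ring_length R) + enat (ring_length R)"
      using submodule_length_kernel_image[OF module_free_module module_regular_module
          coordinate_module_hom[OF i] S, of "insert i A"] insert.IH insert.prems
      unfolding kernel image ring_length_enat by simp
    then show ?case
      using insert.hyps by simp
  qed
qed

lemma full_code_length:
  "submodule_length R (free_module R n) (carrier (free_module R n)) = enat (n * ring_length R)"
proof -
  have "supported_code R n (carrier (free_module R n)) {1..n} = carrier (free_module R n)"
    by (auto simp: supported_code_def supp_def)
  then show ?thesis
    using supported_code_length[of "{1..n}" n] by simp
qed

lemma code_length_enat:
  assumes "is_code R n C"
  shows "submodule_length R (free_module R n) C = enat (code_length R n C)"
proof -
  have "submodule_length R (free_module R n) C \<le> enat (n * ring_length R)"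
    using module.submodule_length_mono[OF module_free_module assms full_code code_subset[OF assms]]
    unfolding full_code_length .
  then show ?thesis
    by (cases "submodule_length R (free_module R n) C") (auto simp: code_length_def)
qed

lemma code_length_strict_mono:
  assumes "is_code R n C" "is_code R n D" "C \<subset> D"
  shows "code_length R n C < code_length R n D"
  using module.submodule_length_strict_mono[OF module_free_module assms] assms(1,2)
  by (simp add: code_length_enat one_enat_def)

lemma code_length_kernel_image:
  assumes "f \<in> module_hom R (free_module R n) (free_module R n)" "is_code R n C"
  shows "code_length R n C =
    code_length R n {v \<in> C. f v = \<zero>\<^bsub>free_module R n\<^esub>} + code_length R n (f ` C)"
proof -
  note hom = module_free_module module_free_module assms(1)
  show ?thesis
    using submodule_length_kernel_image[OF hom assms(2)]
      code_length_enat[OF assms(2)] code_length_enat[OF submodule_image[OF hom assms(2)]]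
      code_length_enat[OF submodule_kernel[OF hom assms(2)]]
    by simp
qed

text \<open>
  Let \<open>e\<close> generate \<open>E\<close> over \<open>D\<close>. Pairing with \<open>e\<close> maps the orthogonal code of \<open>D\<close> to \<open>R\<close> with the orthogonal
  code of \<open>E\<close> as kernel. Since the maximal ideal sends \<open>e\<close> into \<open>D\<close>, the values lie in the socle, whose length
  is at most one.
\<close>

lemma dual_length_cover:
  assumes "covers R (free_module R n) D E"
  shows "code_length R n (orthogonal_code R n D) \<le> code_length R n (orthogonal_code R n E) + 1"
proof -
  interpret F: module R "free_module R n" by (rule module_free_module)
  have DE: "is_code R n D" "is_code R n E" "D \<subset> E"
    using assms by (auto simp: covers_def)
  note D = code_subset[OF DE(1)] and E = code_subset[OF DE(2)]
  obtain e where e: "e \<in> E" "e \<notin> D"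
    using DE(3) by blast
  have ec: "e \<in> carrier (free_module R n)"
    using e(1) E by blast
  note hom = module_free_module module_regular_module dot_module_hom[OF ec]
  let ?D' = "orthogonal_code R n D" and ?E' = "orthogonal_code R n E"
  have D': "is_code R n ?D'" and E': "is_code R n ?E'"
    using orthogonal_code_is_code D E by auto
  have ann: "{r \<in> carrier R. r \<odot>\<^bsub>free_module R n\<^esub> e \<in> D} = \<mm>"
    by (rule cover_annihilator[OF module_free_module assms e])
  have E_eq: "E = {d \<oplus>\<^bsub>free_module R n\<^esub> r \<odot>\<^bsub>free_module R n\<^esub> e | d r. d \<in> D \<and> r \<in> carrier R}"
    by (rule F.cover_adjoin[OF assms e])
  have kernel: "{v \<in> ?D'. dot R n v e = \<zero>\<^bsub>regular_module R\<^esub>} = ?E'"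
  proof (intro equalityI subsetI)
    fix v assume v: "v \<in> {v \<in> ?D'. dot R n v e = \<zero>\<^bsub>regular_module R\<^esub>}"
    then have vc: "v \<in> carrier (free_module R n)" "\<And>d. d \<in> D \<Longrightarrow> dot R n v d = \<zero>" "dot R n v e = \<zero>"
      by (auto simp: orthogonal_code_def simp del: free_module_simps)
    have "dot R n v w = \<zero>" if w: "w \<in> E" for w
    proof -
      obtain d r where "w = d \<oplus>\<^bsub>free_module R n\<^esub> r \<odot>\<^bsub>free_module R n\<^esub> e" "d \<in> D" "r \<in> carrier R"
        using w E_eq by auto
      moreover from this have "d \<in> carrier (free_module R n)"
        using D by blast
      ultimately show ?thesis
        using vc ec by (simp add: dot_add_right dot_smult_right del: free_module_simps)
    qed
    then show "v \<in> ?E'"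
      using vc(1) by (simp add: orthogonal_code_def)
  next
    fix v assume "v \<in> ?E'"
    then show "v \<in> {v \<in> ?D'. dot R n v e = \<zero>\<^bsub>regular_module R\<^esub>}"
      using e(1) DE(3) by (auto simp: orthogonal_code_def simp del: free_module_simps)
  qed
  have "(\<lambda>v. dot R n v e) ` ?D' \<subseteq> socle R \<mm>"
  proof clarify
    fix v assume v: "v \<in> ?D'"
    then have vc: "v \<in> carrier (free_module R n)"
      by (simp add: orthogonal_code_def)
    have "a \<otimes> dot R n v e = \<zero>" if "a \<in> \<mm>" for a
    proof -
      have "a \<in> carrier R" "a \<odot>\<^bsub>free_module R n\<^esub> e \<in> D"
        using that ann by blast+
      then show ?thesis
        using v dot_smult_right[OF vc ec, of a] by (simp add: orthogonal_code_def del: free_module_simps)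
    qed
    then show "dot R n v e \<in> socle R \<mm>"
      using dot_closed[OF vc ec] by (simp add: socle_def)
  qed
  then have "submodule_length R (regular_module R) ((\<lambda>v. dot R n v e) ` ?D') \<le> 1"
    using submodule_image[OF hom D'] length_in_socle by (simp add: submodule_regular_module_iff)
  then have "submodule_length R (free_module R n) ?D' \<le> submodule_length R (free_module R n) ?E' + 1"
    unfolding submodule_length_kernel_image[OF hom D'] kernel by (rule add_left_mono)
  then show ?thesis
    using code_length_enat[OF D'] code_length_enat[OF E'] by (simp add: one_enat_def)
qed

text \<open>
  Along a cover the length of the code grows by at least one, while that of the orthogonal code drops by at
  most one. An inclusion that is neither an equality nor a cover splits into two with smaller differences of
  length.
\<close>

lemma dual_length_sum_mono:
  assumes "is_code R n D" "is_code R n E" "D \<subseteq> E"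
  shows "code_length R n D + code_length R n (orthogonal_code R n D)
    \<le> code_length R n E + code_length R n (orthogonal_code R n E)"
  using assms
proof (induction "code_length R n E - code_length R n D" arbitrary: D E rule: less_induct)
  case less
  consider "D = E" | "covers R (free_module R n) D E"
    | X where "is_code R n X" "D \<subset> X" "X \<subset> E"
    using less.prems unfolding covers_def by blast
  then show ?case
  proof cases
    case 1
    then show ?thesis by simp
  next
    case 2
    then have "code_length R n D < code_length R n E"
      using less.prems by (intro code_length_strict_mono) (auto simp: covers_def)
    then show ?thesis
      using dual_length_cover[OF 2] by simp
  next
    case 3
    have "code_length R n D < code_length R n X" "code_length R n X < code_length R n E"
      using 3 less.prems by (auto intro: code_length_strict_mono)
    then have "code_length R n D + code_length R n (orthogonal_code R n D)
        \<le> code_length R n X + code_length R n (orthogonal_code R n X)"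
      and "code_length R n X + code_length R n (orthogonal_code R n X)
        \<le> code_length R n E + code_length R n (orthogonal_code R n E)"
      using 3 less.prems by (auto intro!: less.hyps)
    then show ?thesis
      by (rule order_trans)
  qed
qed

text \<open>
  The sum of the two lengths is monotone in the code and takes the value \<open>n \<lambda>(R)\<close> both at the zero code and
  at the whole space, so it is constant.
\<close>

theorem dual_code_length:
  assumes C: "is_code R n C"
  shows "code_length R n C + code_length R n (orthogonal_code R n C) = n * ring_length R"
proof -
  interpret F: module R "free_module R n" by (rule module_free_module)
  have zero: "code_length R n {\<zero>\<^bsub>free_module R n\<^esub>} = 0"
    using F.submodule_length_zero by (simp add: code_length_def zero_enat_def)
  have full: "code_length R n (carrier (free_module R n)) = n * ring_length R"
    using full_code_length by (simp add: code_length_def)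
  have "{\<zero>\<^bsub>free_module R n\<^esub>} \<subseteq> C"
    using C by (auto simp: F.submodule_iff)
  from dual_length_sum_mono[OF F.zero_submodule C this]
    and dual_length_sum_mono[OF C full_code code_subset[OF C]]
  show ?thesis
    unfolding orthogonal_code_zero orthogonal_code_full zero full by simp
qed

text \<open>
  Write \<open>\<pi>\<close> for the projection onto \<open>B\<close> and \<open>A\<close> for the complement of \<open>B\<close>. The kernel of \<open>\<pi>\<close> on \<open>C\<close> is \<open>C(A)\<close>.
  As \<open>\<pi>\<close> is self-adjoint, it maps the orthogonal code of \<open>\<pi> C\<close> onto the words of the orthogonal code of \<open>C\<close>
  that are supported in \<open>B\<close>, and the kernel there consists of all words supported in \<open>A\<close>. Comparing lengths
  and applying duality to \<open>\<pi> C\<close> gives the formula.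
\<close>

theorem supported_dual_code_length:
  assumes C: "is_code R n C" and B: "B \<subseteq> {1..n}"
  shows "code_length R n C + code_length R n (supported_code R n (orthogonal_code R n C) B) =
    code_length R n (supported_code R n C ({1..n} - B)) + card B * ring_length R"
proof -
  interpret F: module R "free_module R n" by (rule module_free_module)
  let ?\<pi> = "restrict_support n B" and ?A = "{1..n} - B"
  let ?P = "?\<pi> ` C"
  let ?P' = "orthogonal_code R n ?P"
  note hom = module_free_module module_free_module restrict_support_module_hom
  have Cc: "C \<subseteq> carrier (free_module R n)"
    by (rule code_subset[OF C])
  have P: "is_code R n ?P"
    by (rule submodule_image[OF hom C])
  have Pc: "?P \<subseteq> carrier (free_module R n)"
    by (rule code_subset[OF P])
  have P': "is_code R n ?P'"
    by (rule orthogonal_code_is_code[OF Pc])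
  have mem_P': "v \<in> ?P' \<longleftrightarrow> (\<forall>c\<in>C. dot R n (?\<pi> v) c = \<zero>)" if "v \<in> carrier (free_module R n)" for v
    using that dot_restrict_support[OF that] Cc
    by (auto simp: orthogonal_code_def subset_iff simp del: free_module_simps)
  have kernel: "{v \<in> ?P'. ?\<pi> v = \<zero>\<^bsub>free_module R n\<^esub>} =
      supported_code R n (carrier (free_module R n)) ?A"
  proof (intro equalityI subsetI)
    fix v assume "v \<in> {v \<in> ?P'. ?\<pi> v = \<zero>\<^bsub>free_module R n\<^esub>}"
    then show "v \<in> supported_code R n (carrier (free_module R n)) ?A"
      unfolding restrict_support_eq_zero by (auto simp: supported_code_def orthogonal_code_def)
  next
    fix v assume v: "v \<in> supported_code R n (carrier (free_module R n)) ?A"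
    then have vc: "v \<in> carrier (free_module R n)" and zero: "?\<pi> v = \<zero>\<^bsub>free_module R n\<^esub>"
      unfolding restrict_support_eq_zero by (auto simp: supported_code_def)
    have "v \<in> ?P'"
      unfolding mem_P'[OF vc] zero using Cc by (auto simp: dot_zero_left simp del: free_module_simps)
    then show "v \<in> {v \<in> ?P'. ?\<pi> v = \<zero>\<^bsub>free_module R n\<^esub>}"
      using zero by simp
  qed
  have image: "?\<pi> ` ?P' = supported_code R n (orthogonal_code R n C) B"
  proof (intro equalityI subsetI)
    fix w assume "w \<in> ?\<pi> ` ?P'"
    then obtain v where v: "v \<in> ?P'" "w = ?\<pi> v"
      by blast
    then have "v \<in> carrier (free_module R n)"
      by (simp add: orthogonal_code_def)
    then have "w \<in> orthogonal_code R n C"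
      using v mem_P' module_hom_closed[OF hom] by (simp add: orthogonal_code_def)
    then show "w \<in> supported_code R n (orthogonal_code R n C) B"
      using v(2) supp_restrict_support by (simp add: supported_code_def)
  next
    fix v assume v: "v \<in> supported_code R n (orthogonal_code R n C) B"
    then have vc: "v \<in> carrier (free_module R n)" and eq: "?\<pi> v = v"
      by (auto simp: supported_code_def orthogonal_code_def intro!: restrict_support_eq_self)
    then have "v \<in> ?P'"
      using mem_P'[OF vc] v by (auto simp: supported_code_def orthogonal_code_def)
    then show "v \<in> ?\<pi> ` ?P'"
      using eq by (metis imageI)
  qed
  have "{v \<in> C. ?\<pi> v = \<zero>\<^bsub>free_module R n\<^esub>} = supported_code R n C ?A"
    unfolding restrict_support_eq_zero by (simp add: supported_code_def)
  then have "code_length R n C = code_length R n (supported_code R n C ?A) + code_length R n ?P"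
    using code_length_kernel_image[OF restrict_support_module_hom[where B = B] C] by simp
  moreover have "code_length R n ?P' =
      card ?A * ring_length R + code_length R n (supported_code R n (orthogonal_code R n C) B)"
    using code_length_kernel_image[OF restrict_support_module_hom[where B = B] P']
      supported_code_length[of ?A n]
    unfolding kernel image by (simp add: code_length_def)
  moreover have "code_length R n ?P + code_length R n ?P' = n * ring_length R"
    by (rule dual_code_length[OF P])
  moreover have "card ?A + card B = n"
    using B by (simp add: card_Diff_subset finite_subset card_mono[of "{1..n}", simplified])
  then have "n * ring_length R = card ?A * ring_length R + card B * ring_length R"
    by (metis distrib_right)
  ultimately show ?thesis
    by simp
qed

end


section \<open>The weight enumerator\<close>

lemma weight_poly_eq:
  "weight_poly R n C i z = (\<Sum>A | A \<subseteq> {1..n} \<and> card A \<le> i.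
    (-1) ^ (i - card A) * of_nat ((n - card A) choose (i - card A)) *
      z ^ code_length R n (supported_code R n C A))"
proof -
  let ?S = "{A. A \<subseteq> {1..n} \<and> card A \<le> i}"
  have "finite ?S"
    by (rule finite_subset[of _ "Pow {1..n}"]) auto
  have "weight_poly R n C i z = (\<Sum>a\<in>{0..i}. \<Sum>A\<in>{A \<in> ?S. card A = a}.
    (-1) ^ (i - card A) * of_nat ((n - card A) choose (i - card A)) *
      z ^ code_length R n (supported_code R n C A))"
    unfolding weight_poly_def by (intro sum.cong) auto
  also have "\<dots> = (\<Sum>A\<in>?S.
    (-1) ^ (i - card A) * of_nat ((n - card A) choose (i - card A)) *
      z ^ code_length R n (supported_code R n C A))"
    using \<open>finite ?S\<close> by (intro sum.group) auto
  finally show ?thesis .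
qed

lemma binomial_tail:
  fixes x y :: "'p :: comm_ring_1"
  assumes "a \<le> n"
  shows "(\<Sum>i=a..n. (-1) ^ (i - a) * of_nat ((n - a) choose (i - a)) * x ^ (n - i) * y ^ i) =
    y ^ a * (x - y) ^ (n - a)"
proof -
  have "(\<Sum>i=a..n. (-1) ^ (i - a) * of_nat ((n - a) choose (i - a)) * x ^ (n - i) * y ^ i) =
    (\<Sum>j=0..n-a. y ^ a * (of_nat ((n - a) choose j) * (- y) ^ j * x ^ (n - a - j)))"
    unfolding sum.atLeastAtMost_shift_0[OF assms]
  proof (rule sum.cong)
    fix j assume "j \<in> {0..n-a}"
    then show "((\<lambda>i. (-1) ^ (i - a) * of_nat ((n - a) choose (i - a)) * x ^ (n - i) * y ^ i) \<circ> plus a) j =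
      y ^ a * (of_nat ((n - a) choose j) * (- y) ^ j * x ^ (n - a - j))"
      by (simp add: power_add power_minus[of y j] ac_simps)
  qed simp
  also have "\<dots> = y ^ a * (- y + x) ^ (n - a)"
    unfolding binomial_ring by (simp add: sum_distrib_left atLeast0AtMost)
  finally show ?thesis
    by simp
qed

text \<open>
  Exchanging the sums over \<open>i\<close> and \<open>A\<close> turns the inner sum into a binomial expansion. In this form the
  substitution of the duality formula just exchanges the roles of \<open>y\<close> and \<open>x - y\<close>, up to a power of \<open>z\<close>.
\<close>

theorem weight_enumerator_eq:
  "weight_enumerator R n C x y z =
    (\<Sum>A\<in>Pow {1..n}. z ^ code_length R n (supported_code R n C A) * y ^ card A * (x - y) ^ (n - card A))"
proof -
  let ?c = "\<lambda>i A. (-1) ^ (i - card A) * of_nat ((n - card A) choose (i - card A)) * x ^ (n - i) * y ^ i"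
  let ?l = "\<lambda>A. z ^ code_length R n (supported_code R n C A)"
  have "weight_enumerator R n C x y z =
      (\<Sum>i\<in>{0..n}. \<Sum>A | A \<in> Pow {1..n} \<and> card A \<le> i. ?l A * ?c i A)"
    unfolding weight_enumerator_def weight_poly_eq
    by (intro sum.cong refl) (simp add: sum_distrib_left ac_simps)
  also have "\<dots> = (\<Sum>A\<in>Pow {1..n}. \<Sum>i | i \<in> {0..n} \<and> card A \<le> i. ?l A * ?c i A)"
    by (rule sum.swap_restrict) auto
  also have "\<dots> = (\<Sum>A\<in>Pow {1..n}. ?l A * (y ^ card A * (x - y) ^ (n - card A)))"
  proof (rule sum.cong)
    fix A assume "A \<in> Pow {1..n}"
    then have "card A \<le> n"
      using card_mono[of "{1..n}" A] by simp
    moreover have "{i. i \<in> {0..n} \<and> card A \<le> i} = {card A..n}"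
      by auto
    ultimately show "(\<Sum>i | i \<in> {0..n} \<and> card A \<le> i. ?l A * ?c i A) =
        ?l A * (y ^ card A * (x - y) ^ (n - card A))"
      using binomial_tail[of "card A" n x y] by (simp add: sum_distrib_left[symmetric])
  qed simp
  finally show ?thesis
    by (simp add: mult.assoc)
qed

lemma var_z_inverse: "var_z_inv * var_z = 1"
  by (simp add: var_z_inv_def var_z_def mult_single flip: zero_prod_def single_one)

theorem theorem4:
  fixes R :: "('a, 'c) ring_scheme" and \<mm> :: "'a set" and n :: nat and C :: "(nat \<Rightarrow> 'a) set"
  assumes "frobenius_ring R \<mm>" and "n \<ge> 1" and "is_code R n C"
  shows "weight_enumerator R n (orthogonal_code R n C) var_x var_y var_z =
    var_z_inv ^ code_length R n C *
      weight_enumerator R n C (var_x + var_z ^ ring_length R * var_y - var_y) (var_x - var_y) var_z"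
proof -
  interpret frobenius_ring R \<mm>
    by (rule assms(1))
  let ?C' = "orthogonal_code R n C" and ?L = "ring_length R" and ?len = "code_length R n"
  have "(\<Sum>B\<in>Pow {1..n}. var_z ^ ?len (supported_code R n ?C' B) * var_y ^ card B * (var_x - var_y) ^ (n - card B)) =
    (\<Sum>A\<in>Pow {1..n}. var_z_inv ^ ?len C * (var_z ^ ?len (supported_code R n C A) *
      (var_x - var_y) ^ card A * (var_z ^ ?L * var_y) ^ (n - card A)))"
  proof (rule sum.reindex_bij_witness[of _ "\<lambda>A. {1..n} - A" "\<lambda>A. {1..n} - A"])
    fix B assume B: "B \<in> Pow {1..n}"
    then have card: "card ({1..n} - B) = n - card B" "card B \<le> n"
      using card_mono[of "{1..n}" B] by (auto simp: card_Diff_subset finite_subset)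
    have "var_z_inv ^ ?len C * (var_z ^ ?len (supported_code R n C ({1..n} - B)) * var_z ^ (card B * ?L)) =
      var_z_inv ^ ?len C * (var_z ^ ?len C * var_z ^ ?len (supported_code R n ?C' B))"
      using supported_dual_code_length[OF assms(3), of B] B by (simp flip: power_add)
    also have "\<dots> = (var_z_inv * var_z) ^ ?len C * var_z ^ ?len (supported_code R n ?C' B)"
      by (simp only: power_mult_distrib mult.assoc)
    also have "\<dots> = var_z ^ ?len (supported_code R n ?C' B)"
      by (simp add: var_z_inverse)
    finally have "var_z ^ ?len (supported_code R n ?C' B) =
      var_z_inv ^ ?len C * (var_z ^ ?len (supported_code R n C ({1..n} - B)) * (var_z ^ ?L) ^ card B)"
      by (simp add: power_mult[symmetric] mult.commute[of "card B"])
    then show "var_z_inv ^ ?len C * (var_z ^ ?len (supported_code R n C ({1..n} - B)) *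
        (var_x - var_y) ^ card ({1..n} - B) * (var_z ^ ?L * var_y) ^ (n - card ({1..n} - B))) =
      var_z ^ ?len (supported_code R n ?C' B) * var_y ^ card B * (var_x - var_y) ^ (n - card B)"
      using card by (simp add: power_mult_distrib ac_simps)
  qed auto
  moreover have "var_x + var_z ^ ?L * var_y - var_y - (var_x - var_y) = var_z ^ ?L * var_y"
    by simp
  ultimately show ?thesis
    unfolding weight_enumerator_eq by (simp add: sum_distrib_left)
qed

end
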